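(* Let $p \ge 3$, let $\Sigma$ be any $p\times p$ covariance matrix (positive semi-definite, possibly singular), let $Z=(Z_1,\dots,Z_p) \sim N(0,\Sigma)$ be a centered Gaussian vector in $\mathbb{R}^p$, write $\sigma_i = (\mathbb{E}[Z_i^2])^{1/2} \ge 0$, and let $M = \max_{1 \le i \le p} Z_i$. For $t>0$ define the effective dimension $$p^*(t) = \max\left\{ \#\left\{1 \le i \le p : \sigma_i \ge t\,(2 \log p + 2\log\log p)^{-1/2}\right\},\; 2\right\}.$$ Then, for every $t > 0$, $$\lim_{\delta \downarrow 0} \frac{1}{\delta}\, \mathbb{P}\left\{ t \le M < t+ \delta \right\} \;\le\; 4 \min\left\{ \frac{\log p^*(t) + \frac14}{t},\; \frac{ \log p}{t}\right\}.$$
   Context: $\log$ is the natural logarithm and $\#$ denotes cardinality. Coordinates with $\sigma_i=0$ are allowed. *)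

theory Defs
  imports "HOL-Probability.Probability"
begin

definition pos_semidefinite :: "real^'n^'n \<Rightarrow> bool" where
  "pos_semidefinite A \<longleftrightarrow> transpose A = A \<and> (\<forall>x. 0 \<le> x \<bullet> (A *v x))"

text \<open>
  The second parameter is the variance (not the standard deviation, as in
  \<^const>\<open>normal_density\<close>); variance zero gives the Dirac measure at the mean.
\<close>

definition gaussian_measure :: "real \<Rightarrow> real \<Rightarrow> real measure" where
  "gaussian_measure m v =
     (if v = 0 then return borel m
      else density lborel (\<lambda>x. ennreal (normal_density m (sqrt v) x)))"

text \<open>
  A random vector is Gaussian iff all its one-dimensional linear images are Gaussian, where
  point masses count as Gaussian. The covariance matrix may therefore be singular, in which
  case the vector has no density with respect to Lebesgue measure.
\<close>

definition centered_gaussian_vector ::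
  "'a measure \<Rightarrow> ('a \<Rightarrow> real^'n) \<Rightarrow> real^'n^'n \<Rightarrow> bool" where
  "centered_gaussian_vector P Z \<Sigma> \<longleftrightarrow>
     prob_space P \<and> Z \<in> borel_measurable P \<and>
     (\<forall>a. distr P borel (\<lambda>\<omega>. a \<bullet> Z \<omega>) = gaussian_measure 0 (a \<bullet> (\<Sigma> *v a)))"

definition coord_sd :: "'a measure \<Rightarrow> ('a \<Rightarrow> real^'n) \<Rightarrow> 'n \<Rightarrow> real" where
  "coord_sd P Z i = sqrt (\<integral>\<omega>. (Z \<omega> $ i)\<^sup>2 \<partial>P)"

definition effective_dim :: "'a measure \<Rightarrow> ('a \<Rightarrow> real^'n) \<Rightarrow> real \<Rightarrow> nat" where
  "effective_dim P Z t =
     max (card {i. coord_sd P Z i \<ge>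
                 t * (2 * ln (real CARD('n)) + 2 * ln (ln (real CARD('n)))) powr (- 1 / 2)})
         2"

end

theory Submission
  imports Defs "HOL-Real_Asymp.Real_Asymp"
begin

text \<open>
  Split \<open>t \<le> M < t + \<delta>\<close> according to the first coordinate \<open>i\<close> attaining the maximum. The residual of
  \<open>Z\<close> after regression on \<open>Z\<^sub>i\<close> is independent of \<open>Z\<^sub>i\<close>, so \<open>M\<close> has on the positive half-line the density
  \<open>f s = (\<Sum>i. \<phi>\<^sub>i s * g\<^sub>i s)\<close>, where \<open>\<phi>\<^sub>i\<close> is the density of \<open>Z\<^sub>i\<close> and \<open>g\<^sub>i s\<close> is the probability that the
  residual satisfies finitely many inequalities affine in \<open>s\<close>. Each of these inequalities is
  eventually constant as \<open>s \<down> t\<close>, so \<open>f\<close> has a right limit at \<open>t\<close>, which is the limit sought.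

  For the bound (Nazarov's argument), \<open>P (Z\<^sub>i > s) * g\<^sub>i s\<close> is the probability of the strip of points that
  project into the \<open>i\<close>-th face of the polyhedron \<open>max z \<le> s\<close>. By Cauchy-Schwarz the strips are disjoint,
  so these weights sum to at most 1. With \<open>r\<^sub>i = s / \<sigma>\<^sub>i\<close> the Mills ratio gives
  \<open>s * \<phi>\<^sub>i s \<le> (r\<^sub>i\<^sup>2 + 1) * P (Z\<^sub>i > s)\<close>. This is used for \<open>r\<^sub>i \<le> sqrt (2 * ln m)\<close>, where \<open>m\<close> is the effective
  or the full dimension; a larger \<open>r\<^sub>i\<close> contributes at most the value of \<open>r * \<phi> r\<close> at the threshold,
  and the coordinates not counted by the effective dimension contribute at most \<open>0.58\<close> in total.
\<close>

section \<open>Uniqueness of multivariate characteristic functions\<close>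

text \<open>Divided by its total mass \<open>m\<close>, the weight \<open>w\<close> is a probability
  density, and the law of \<open>X\<close> under it has the two trigonometric integrals, divided by
  \<open>m\<close>, as real and imaginary part of its characteristic function. If
  \<open>m = 0\<close>, then \<open>w\<close> vanishes almost everywhere and both sides are
  0.\<close>

lemma weighted_Levy_uniqueness:
  fixes w X :: "'a \<Rightarrow> real"
  assumes "finite_measure M" "finite_measure N" "sets M = sets N"
    and [measurable]: "w \<in> borel_measurable M" "X \<in> borel_measurable M" "A \<in> sets borel"
    and w: "\<And>x. 0 \<le> w x" "\<And>x. w x \<le> C"
    and cos_eq: "\<And>u. (\<integral>x. w x * cos (u * X x) \<partial>M) = (\<integral>x. w x * cos (u * X x) \<partial>N)"
    and sin_eq: "\<And>u. (\<integral>x. w x * sin (u * X x) \<partial>M) = (\<integral>x. w x * sin (u * X x) \<partial>N)"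
  shows "(\<integral>x. w x * indicator A (X x) \<partial>M) = (\<integral>x. w x * indicator A (X x) \<partial>N)"
proof -
  have [measurable_cong]: "sets N = sets M" using assms(3) by simp
  define m where "m = (\<integral>x. w x \<partial>M)"
  have m_N: "m = (\<integral>x. w x \<partial>N)" using cos_eq[of 0] by (simp add: m_def)
  have m_nonneg: "0 \<le> m" by (simp add: m_def w)
  have int: "integrable Q (\<lambda>x. w x * f x)"
    if "finite_measure Q" "sets Q = sets M" "f \<in> borel_measurable M" "\<And>x. \<bar>f x\<bar> \<le> 1"
    for Q and f :: "'a \<Rightarrow> real"
  proof -
    interpret finite_measure Q by fact
    have [measurable_cong]: "sets Q = sets M" by fact
    have [measurable]: "f \<in> borel_measurable M" by fact
    show ?thesis
    proof (rule integrable_const_bound[where B = C])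
      have "w x * \<bar>f x\<bar> \<le> C * 1" for x
        using w[of x] that(4)[of x] order_trans[OF w] by (intro mult_mono) auto
      then show "AE x in Q. norm (w x * f x) \<le> C"
        using w by (simp add: abs_mult)
    qed measurable
  qed
  have int_w: "integrable Q w" if "finite_measure Q" "sets Q = sets M" for Q
    using int[OF that, of "\<lambda>_. 1"] by simp
  show ?thesis
  proof (cases "m = 0")
    case True
    have "(\<integral>x. w x * indicator A (X x) \<partial>Q) = 0"
      if Q: "finite_measure Q" "sets Q = sets M" "(\<integral>x. w x \<partial>Q) = 0" for Q
    proof -
      have [measurable_cong]: "sets Q = sets M" by fact
      have "AE x in Q. w x = 0"
        using Q w by (subst integral_nonneg_eq_0_iff_AE[symmetric]) (auto intro: int_w)
      then have "(\<integral>x. w x * indicator A (X x) \<partial>Q) = (\<integral>x. 0 \<partial>Q)"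
        by (intro integral_cong_AE) auto
      then show ?thesis by simp
    qed
    then show ?thesis using True m_N assms(1,2,3) m_def by metis
  next
    case False
    with m_nonneg have m: "m > 0" by simp
    define D where "D Q = distr (density Q (\<lambda>x. ennreal (w x / m))) borel X" for Q
    have D: "real_distribution (D Q)"
      and D_int: "(\<integral>y. g y \<partial>D Q) = (\<integral>x. (w x / m) *\<^sub>R g (X x) \<partial>Q)"
      if Q: "finite_measure Q" "sets Q = sets M" "(\<integral>x. w x \<partial>Q) = m"
        and "g \<in> borel_measurable borel" for Q and g :: "real \<Rightarrow> complex"
    proof -
      have [measurable_cong]: "sets Q = sets M" by fact
      have [measurable]: "g \<in> borel_measurable borel" by fact
      have "(\<integral>\<^sup>+x. ennreal (w x / m) \<partial>Q) = ennreal (\<integral>x. w x / m \<partial>Q)"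
        using int_w[OF Q(1,2)] w m by (intro nn_integral_eq_integral) (auto intro: divide_nonneg_pos)
      also have "\<dots> = 1" using Q m by simp
      finally have "(\<integral>\<^sup>+x. ennreal (w x / m) \<partial>Q) = 1" .
      then have "prob_space (density Q (\<lambda>x. ennreal (w x / m)))"
        by (intro prob_spaceI) (simp add: emeasure_density cong: nn_integral_cong_simp)
      then show "real_distribution (D Q)"
        unfolding D_def real_distribution_def real_distribution_axioms_def
        by (auto intro!: prob_space.prob_space_distr)
      show "(\<integral>y. g y \<partial>D Q) = (\<integral>x. (w x / m) *\<^sub>R g (X x) \<partial>Q)"
        unfolding D_def using w m by (subst integral_distr) (auto simp: integral_density)
    qed
    have char_D: "char (D Q) u = Complex ((\<integral>x. w x * cos (u * X x) \<partial>Q) / m) ((\<integral>x. w x * sin (u * X x) \<partial>Q) / m)"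
      if Q: "finite_measure Q" "sets Q = sets M" "(\<integral>x. w x \<partial>Q) = m" for Q u
    proof -
      have [measurable_cong]: "sets Q = sets M" by fact
      have "char (D Q) u = (\<integral>x. (w x / m) *\<^sub>R iexp (u * X x) \<partial>Q)"
        unfolding char_def using Q by (subst D_int) auto
      also have "\<dots> = (\<integral>x. complex_of_real (w x * cos (u * X x) / m) + \<i> * complex_of_real (w x * sin (u * X x) / m) \<partial>Q)"
        by (intro Bochner_Integration.integral_cong) (auto simp: complex_eq_iff Re_exp Im_exp)
      also have "\<dots> = complex_of_real (\<integral>x. w x * cos (u * X x) / m \<partial>Q) + \<i> * complex_of_real (\<integral>x. w x * sin (u * X x) / m \<partial>Q)"
        using int[OF Q(1,2), of "\<lambda>x. cos (u * X x)"] int[OF Q(1,2), of "\<lambda>x. sin (u * X x)"]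
        by (subst Bochner_Integration.integral_add)
           (auto simp del: of_real_mult of_real_divide intro!: integrable_of_real integrable_mult_right)
      finally show ?thesis by (simp add: complex_eq_iff)
    qed
    have "char (D M) = char (D N)"
      using assms(1-3) m_N m_def cos_eq sin_eq by (intro ext) (simp add: char_D)
    then have DD: "D M = D N"
      using assms(1-3) m_N m_def by (intro Levy_uniqueness D[where g = "\<lambda>_. 0"]) auto
    have "(\<integral>x. w x * indicator A (X x) \<partial>Q) = m * Re (\<integral>y. complex_of_real (indicator A y) \<partial>D Q)"
      if Q: "finite_measure Q" "sets Q = sets M" "(\<integral>x. w x \<partial>Q) = m" for Q
    proof -
      have "(\<integral>y. complex_of_real (indicator A y) \<partial>D Q) = (\<integral>x. complex_of_real (w x * indicator A (X x) / m) \<partial>Q)"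
        using Q by (subst D_int) (auto simp: scaleR_conv_of_real)
      also have "\<dots> = complex_of_real (\<integral>x. w x * indicator A (X x) / m \<partial>Q)"
        by (rule integral_complex_of_real)
      finally show ?thesis using m by simp
    qed
    then show ?thesis using assms(1-3) m_N m_def DD by simp
  qed
qed

text \<open>
  Indicators of coordinate slabs replace the factors of a trigonometric monomial one coordinate
  at a time. Since one-dimensional uniqueness needs nonnegative weights, it is applied with
  \<open>1 + cos\<close> in place of \<open>cos\<close>.
\<close>

lemma char_uniqueness:
  fixes M N :: "'a::euclidean_space measure"
  assumes "prob_space M" "prob_space N"
    and [measurable_cong]: "sets M = sets borel" "sets N = sets borel"
    and char_eq: "\<And>a. (CLINT x|M. iexp (a \<bullet> x)) = (CLINT x|N. iexp (a \<bullet> x))"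
  shows "M = N"
proof -
  interpret M: prob_space M by fact
  interpret N: prob_space N by fact
  \<comment> \<open>The free phase \<open>r\<close> lets one family of real identities carry both
    the real and the imaginary part.\<close>
  have cos_eq: "(\<integral>x. cos (a \<bullet> x - r) \<partial>M) = (\<integral>x. cos (a \<bullet> x - r) \<partial>N)" for a r
  proof -
    have "(\<integral>x. cos (a \<bullet> x - r) \<partial>Q) = Re (exp (- \<i> * r) * (CLINT x|Q. iexp (a \<bullet> x)))"
      if Q: "prob_space Q" "sets Q = sets borel" for Q
    proof -
      interpret Q: prob_space Q by fact
      have [measurable_cong]: "sets Q = sets borel" by fact
      have i: "integrable Q (\<lambda>x. iexp (a \<bullet> x))" by (intro Q.integrable_iexp) auto
      have "Re (exp (- \<i> * r) * (CLINT x|Q. iexp (a \<bullet> x))) = Re (CLINT x|Q. exp (- \<i> * r) * iexp (a \<bullet> x))"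
        using i by simp
      also have "\<dots> = (\<integral>x. Re (exp (- \<i> * r) * iexp (a \<bullet> x)) \<partial>Q)"
        using i by (subst integral_Re) auto
      also have "\<dots> = (\<integral>x. cos (a \<bullet> x - r) \<partial>Q)"
        by (simp add: Re_exp Im_exp cos_diff mult.commute)
      finally show ?thesis ..
    qed
    then show ?thesis using assms by metis
  qed
  define K where "K J B x = (\<Prod>k\<in>J. indicator (B k) (x \<bullet> k) :: real)" for J and B :: "'a \<Rightarrow> real set" and x
  have step: "(\<integral>x. K J B x * cos (a \<bullet> x - r) \<partial>M) = (\<integral>x. K J B x * cos (a \<bullet> x - r) \<partial>N)"
    if J: "finite J" and B: "\<And>k. B k \<in> sets borel" for J B a r
    using J
  proof (induction J arbitrary: a r)
    case empty
    then show ?case using cos_eq by (simp add: K_def)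
  next
    case (insert k J)
    have [measurable]: "B k \<in> sets borel" for k by fact
    have [measurable]: "K J B \<in> borel_measurable borel"
      unfolding K_def by measurable
    have K01: "0 \<le> K J B x" "K J B x \<le> 1" for x
      unfolding K_def by (auto intro!: prod_nonneg prod_le_1)
    have int: "integrable Q (\<lambda>x. K J B x * f x)"
      if "prob_space Q" "sets Q = sets borel" "f \<in> borel_measurable borel" "\<And>x. \<bar>f x\<bar> \<le> 1"
      for Q and f :: "'a \<Rightarrow> real"
    proof -
      interpret prob_space Q by fact
      have [measurable_cong]: "sets Q = sets borel" by fact
      have [measurable]: "f \<in> borel_measurable borel" by fact
      show ?thesis
      proof (rule integrable_const_bound[where B = 1])
        have "K J B x * \<bar>f x\<bar> \<le> 1 * 1" for x
          using K01[of x] that(4)[of x] by (intro mult_mono) auto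
        then show "AE x in Q. norm (K J B x * f x) \<le> 1"
          using K01 by (simp add: abs_mult)
      qed measurable
    qed
    have key: "(\<integral>x. K J B x * (1 + cos (a \<bullet> x - r)) * indicator (B k) (x \<bullet> k) \<partial>M) =
               (\<integral>x. K J B x * (1 + cos (a \<bullet> x - r)) * indicator (B k) (x \<bullet> k) \<partial>N)" for a r
    proof (rule weighted_Levy_uniqueness[where C = 2])
      have weight_nonneg: "0 \<le> 1 + cos (a \<bullet> x - r)" for x
        using cos_ge_minus_one[of "a \<bullet> x - r"] by linarith
      then show "0 \<le> K J B x * (1 + cos (a \<bullet> x - r))" for x
        by (rule mult_nonneg_nonneg[OF K01(1)])
      have "K J B x * (1 + cos (a \<bullet> x - r)) \<le> 1 * 2" for x
        using K01 weight_nonneg cos_le_one[of "a \<bullet> x - r"]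
        by (intro mult_mono weight_nonneg) simp_all
      then show "K J B x * (1 + cos (a \<bullet> x - r)) \<le> 2" for x by simp
      \<comment> \<open>Product-to-sum formulas remove the factor \<open>1 + cos\<close> and leave
        integrals of \<open>K J B\<close> times a single cosine. The induction hypothesis covers
        these because frequency and phase are arbitrary in it.\<close>
      have expand: "(\<integral>x. K J B x * (1 + cos (a \<bullet> x - r)) * cos (u * (x \<bullet> k) - s) \<partial>Q) =
         (\<integral>x. K J B x * cos ((u *\<^sub>R k) \<bullet> x - s) \<partial>Q) +
         ((\<integral>x. K J B x * cos ((a + u *\<^sub>R k) \<bullet> x - (r + s)) \<partial>Q) +
          (\<integral>x. K J B x * cos ((a - u *\<^sub>R k) \<bullet> x - (r - s)) \<partial>Q)) / 2"
        if Q: "prob_space Q" "sets Q = sets borel" for Q u s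
      proof -
        have "K J B x * (1 + cos (a \<bullet> x - r)) * cos (u * (x \<bullet> k) - s) =
          K J B x * cos ((u *\<^sub>R k) \<bullet> x - s) +
           (K J B x * cos ((a + u *\<^sub>R k) \<bullet> x - (r + s)) + K J B x * cos ((a - u *\<^sub>R k) \<bullet> x - (r - s))) / 2" for x
        proof -
          have "cos (p + q) + cos (p - q) = 2 * (cos p * cos q)" for p q :: real
            by (simp add: cos_add cos_diff)
          from this[of "a \<bullet> x - r" "u * (x \<bullet> k) - s"]
          have "cos ((a + u *\<^sub>R k) \<bullet> x - (r + s)) + cos ((a - u *\<^sub>R k) \<bullet> x - (r - s)) =
            2 * (cos (a \<bullet> x - r) * cos (u * (x \<bullet> k) - s))"
            by (simp add: algebra_simps inner_commute)
          moreover have "K' * (1 + c) * q = K' * q + (K' * A + K' * A') / 2"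
            if "A + A' = 2 * (c * q)" for K' c q A A' :: real
          proof -
            have "K' * A + K' * A' = K' * (2 * (c * q))" unfolding that[symmetric] by (rule distrib_left[symmetric])
            then show ?thesis by (simp add: algebra_simps)
          qed
          moreover have "(u *\<^sub>R k) \<bullet> x = u * (x \<bullet> k)"
            by (simp add: inner_commute)
          ultimately show ?thesis by metis
        qed
        then show ?thesis
          using int[OF Q] by simp
      qed
      have shifted: "(\<integral>x. K J B x * (1 + cos (a \<bullet> x - r)) * cos (u * (x \<bullet> k) - s) \<partial>M) =
            (\<integral>x. K J B x * (1 + cos (a \<bullet> x - r)) * cos (u * (x \<bullet> k) - s) \<partial>N)" for u s
        by (simp only: expand[OF assms(1,3)] expand[OF assms(2,4)] insert.IH)
      show "(\<integral>x. K J B x * (1 + cos (a \<bullet> x - r)) * cos (u * (x \<bullet> k)) \<partial>M) =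
            (\<integral>x. K J B x * (1 + cos (a \<bullet> x - r)) * cos (u * (x \<bullet> k)) \<partial>N)" for u
        using shifted[of u 0] by simp
      have sin_cos: "sin y = cos (y - pi / 2)" for y :: real
        by (simp add: cos_diff)
      show "(\<integral>x. K J B x * (1 + cos (a \<bullet> x - r)) * sin (u * (x \<bullet> k)) \<partial>M) =
            (\<integral>x. K J B x * (1 + cos (a \<bullet> x - r)) * sin (u * (x \<bullet> k)) \<partial>N)" for u
        unfolding sin_cos by (rule shifted)
    qed (use assms M.finite_measure_axioms N.finite_measure_axioms in auto)
    have split: "(\<integral>x. K J B x * (1 + cos (a \<bullet> x - r)) * indicator (B k) (x \<bullet> k) \<partial>Q) =
      (\<integral>x. K J B x * indicator (B k) (x \<bullet> k) \<partial>Q) +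
      (\<integral>x. K (insert k J) B x * cos (a \<bullet> x - r) \<partial>Q)"
      if Q: "prob_space Q" "sets Q = sets borel" for Q a r
    proof -
      have "K J B x * (1 + cos (a \<bullet> x - r)) * indicator (B k) (x \<bullet> k) =
        K J B x * indicator (B k) (x \<bullet> k) + K J B x * (indicator (B k) (x \<bullet> k) * cos (a \<bullet> x - r))" for x
        by (simp add: algebra_simps)
      moreover have "K (insert k J) B x = K J B x * indicator (B k) (x \<bullet> k)" for x
        using insert by (simp add: K_def)
      moreover have "\<bar>indicator (B k) (x \<bullet> k) * cos (a \<bullet> x - r)\<bar> \<le> 1" for x :: 'a
        by (simp add: indicator_def)
      ultimately show ?thesis
        using int[OF Q] by (simp add: mult.assoc)
    qed
    \<comment> \<open>The case \<open>a = 0\<close>, \<open>r = 0\<close> of \<open>key\<close> has weight \<open>2 * K J B\<close>.\<close>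
    have "(\<integral>x. K J B x * indicator (B k) (x \<bullet> k) \<partial>M) = (\<integral>x. K J B x * indicator (B k) (x \<bullet> k) \<partial>N)"
      using key[of 0 0] by (simp add: mult.assoc mult.left_commute[of _ 2])
    then show ?case
      using key[of a r] assms by (simp add: split)
  qed
  show ?thesis
  proof (rule measure_eqI_generator_eq[where E = "range (\<lambda>(a, b). box a b)" and \<Omega> = UNIV
        and A = "\<lambda>n::nat. box (- (real n *\<^sub>R One)) (real n *\<^sub>R One)"])
    show "Int_stable (range (\<lambda>(a, b). box a b :: 'a set))"
      by (auto simp: Int_stable_def box_Int_box)
    show "emeasure M X = emeasure N X" if "X \<in> range (\<lambda>(a, b). box a b)" for X
    proof -
      obtain a b :: 'a where X: "X = box a b" using \<open>X \<in> range (\<lambda>(a, b). box a b)\<close> by auto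
      have "K Basis (\<lambda>k. {a \<bullet> k <..< b \<bullet> k}) x = indicator X x" for x
        unfolding K_def X by (auto simp: indicator_def mem_box split: if_splits)
      \<comment> \<open>At frequency and phase zero the cosine is 1, so \<open>step\<close> compares
        the probabilities of the box itself.\<close>
      with step[of Basis "\<lambda>k. {a \<bullet> k <..< b \<bullet> k}" 0 0]
      have "measure M (X \<inter> space M) = measure N (X \<inter> space N)" by simp
      then show ?thesis
        using sets_eq_imp_space_eq[OF assms(3)] sets_eq_imp_space_eq[OF assms(4)]
        by (simp add: M.emeasure_eq_measure N.emeasure_eq_measure)
    qed
    show "sets M = sigma_sets UNIV (range (\<lambda>(a, b). box a b))"
      "sets N = sigma_sets UNIV (range (\<lambda>(a, b). box a b))"
      using assms by (simp_all add: borel_eq_box)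
    show "(\<Union>n. box (- (real n *\<^sub>R One)) (real n *\<^sub>R One)) = (UNIV::'a set)"
      using UN_box_eq_UNIV by simp
  qed auto
qed

section \<open>Regression of a Gaussian vector on one coordinate\<close>

text \<open>For \<open>v > 0\<close> the measure is the law of \<open>sqrt v\<close> times a
  standard normal variable; for \<open>v = 0\<close> it is the point mass at 0, whose characteristic
  function is constantly 1.\<close>

lemma char_gaussian_measure:
  assumes "v \<ge> 0"
  shows "char (gaussian_measure 0 v) u = of_real (exp (- (v * u\<^sup>2) / 2))"
proof (cases "v = 0")
  case True
  then show ?thesis
    by (simp add: gaussian_measure_def char_def integral_return)
next
  case False
  with assms have v: "v > 0" by simp
  interpret std: prob_space std_normal_distribution
    by (rule prob_space_normal_density) simp
  have "distr std_normal_distribution lborel (\<lambda>x. x) = std_normal_distribution"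
    by (rule distr_id2) simp
  then have "distributed std_normal_distribution lborel (\<lambda>x. x) std_normal_density"
    by (simp add: distributed_def)
  then have "distributed std_normal_distribution lborel (\<lambda>x. 0 + sqrt v * x)
      (normal_density (0 + sqrt v * 0) (\<bar>sqrt v\<bar> * 1))"
    using v by (intro std.normal_density_affine) auto
  then have "distr std_normal_distribution lborel (\<lambda>x. sqrt v * x) = gaussian_measure 0 v"
    using v by (simp add: distributed_def gaussian_measure_def)
  then have "char (gaussian_measure 0 v) u = char (distr std_normal_distribution lborel (\<lambda>x. sqrt v * x)) u"
    by simp
  also have "\<dots> = char std_normal_distribution (u * sqrt v)"
    unfolding char_def by (subst integral_distr) (simp_all add: mult.assoc)
  finally show ?thesis
    using v by (simp add: char_std_normal_distribution power_mult_distrib mult.commute)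
qed

lemma prob_space_gaussian_measure: "v \<ge> 0 \<Longrightarrow> prob_space (gaussian_measure 0 v)"
  by (auto simp: gaussian_measure_def intro!: prob_space_return prob_space_normal_density)

lemma sets_gaussian_measure [simp, measurable_cong]: "sets (gaussian_measure m v) = sets borel"
  by (simp add: gaussian_measure_def)

lemma space_gaussian_measure [simp]: "space (gaussian_measure m v) = UNIV"
  by (simp add: gaussian_measure_def)

lemma vec_nth_borel [measurable]: "(\<lambda>z :: real^'n. z $ j) \<in> borel_measurable borel"
proof -
  have "(\<lambda>z :: real^'n. axis j 1 \<bullet> z) \<in> borel_measurable borel" by measurable
  then show ?thesis by (simp add: inner_axis')
qed

locale centered_gaussian =
  fixes P :: "'a measure" and Z :: "'a \<Rightarrow> real^'n" and S :: "real^'n^'n"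
  assumes psd: "pos_semidefinite S" and gaussian: "centered_gaussian_vector P Z S"
begin

sublocale prob_space P
  using gaussian by (simp add: centered_gaussian_vector_def)

lemma measurable_Z [measurable]: "Z \<in> borel_measurable P"
  using gaussian by (simp add: centered_gaussian_vector_def)

lemma measurable_Z_nth [measurable]: "(\<lambda>\<omega>. Z \<omega> $ j) \<in> borel_measurable P"
  by (rule measurable_compose[OF measurable_Z vec_nth_borel])

lemma quadratic_nonneg: "0 \<le> a \<bullet> (S *v a)"
  using psd by (simp add: pos_semidefinite_def)

lemma symmetric_form: "a \<bullet> (S *v b) = b \<bullet> (S *v a)"
proof -
  have "a \<bullet> (S *v b) = (a v* S) \<bullet> b" by (simp add: dot_lmul_matrix)
  also have "a v* S = S *v a"
    using psd by (metis pos_semidefinite_def transpose_matrix_vector)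
  finally show ?thesis by (simp add: inner_commute)
qed

lemma axis_form: "axis i 1 \<bullet> (S *v axis j 1) = S $ i $ j"
  by (simp add: inner_axis' matrix_vector_mult_basis column_def)

lemma symmetric_entry: "S $ i $ j = S $ j $ i"
  using symmetric_form[of "axis i 1" "axis j 1"] by (simp add: axis_form)

lemma diag_nonneg: "0 \<le> S $ i $ i"
  using quadratic_nonneg[of "axis i 1"] by (simp add: axis_form)

lemma quadratic_diff:
  "(a - r *\<^sub>R b) \<bullet> (S *v (a - r *\<^sub>R b)) = a \<bullet> (S *v a) - 2 * r * (a \<bullet> (S *v b)) + r\<^sup>2 * (b \<bullet> (S *v b))"
proof -
  have "S *v (a - r *\<^sub>R b) = S *v a - r *\<^sub>R (S *v b)"
    by (simp add: matrix_vector_mult_diff_distrib matrix_vector_mult_scaleR)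
  then show ?thesis
    using symmetric_form[of a b]
    by (simp add: inner_diff_left inner_diff_right power2_eq_square algebra_simps)
qed

text \<open>The form is nonnegative at the residual of axis \<open>k\<close> after regression on
  axis \<open>i\<close>, and its value there is the Schur complement of
  \<open>S $ i $ i\<close>.\<close>

lemma Cauchy_Schwarz_entry:
  assumes "S $ i $ i > 0"
  shows "(S $ i $ k)\<^sup>2 \<le> S $ i $ i * S $ k $ k"
proof -
  have "0 \<le> S $ k $ k - 2 * (S $ i $ k / S $ i $ i) * S $ i $ k + (S $ i $ k / S $ i $ i)\<^sup>2 * S $ i $ i"
    using quadratic_nonneg[of "axis k 1 - (S $ i $ k / S $ i $ i) *\<^sub>R axis i 1"]
    unfolding quadratic_diff axis_form by (simp add: symmetric_entry[of k i])
  also have "\<dots> = (S $ i $ i * S $ k $ k - (S $ i $ k)\<^sup>2) / S $ i $ i"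
    using assms by (simp add: field_simps power2_eq_square)
  finally show ?thesis
    using assms by (simp add: zero_le_divide_iff)
qed

lemma distr_inner: "distr P borel (\<lambda>\<omega>. a \<bullet> Z \<omega>) = gaussian_measure 0 (a \<bullet> (S *v a))"
  using gaussian by (simp add: centered_gaussian_vector_def)

lemma distr_nth: "distr P borel (\<lambda>\<omega>. Z \<omega> $ i) = gaussian_measure 0 (S $ i $ i)"
  using distr_inner[of "axis i 1", unfolded axis_form] by (simp add: inner_axis')

lemma char_Z: "(CLINT \<omega>|P. iexp (a \<bullet> Z \<omega>)) = of_real (exp (- (a \<bullet> (S *v a)) / 2))"
proof -
  have "(CLINT \<omega>|P. iexp (a \<bullet> Z \<omega>)) = char (distr P borel (\<lambda>\<omega>. a \<bullet> Z \<omega>)) 1"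
    unfolding char_def by (subst integral_distr) auto
  then show ?thesis
    by (simp add: distr_inner char_gaussian_measure quadratic_nonneg)
qed

text \<open>The regression coefficients of all coordinates on coordinate \<open>i\<close>:
  covariance with \<open>Z\<^sub>i\<close> over the variance of \<open>Z\<^sub>i\<close>. For
  variance zero, division by zero makes this the zero vector.\<close>

definition regr :: "'n \<Rightarrow> real^'n" where
  "regr i = (1 / S $ i $ i) *\<^sub>R (S *v axis i 1)"

lemma regr_nth: "regr i $ j = S $ j $ i / S $ i $ i"
  by (simp add: regr_def matrix_vector_mult_basis column_def)

text \<open>The coordinate \<open>i\<close> is independent of the residual \<open>Z - Z\<^sub>i regr i\<close>.\<close>

lemma distr_split:
  assumes v: "S $ i $ i > 0"
  shows "distr P borel Z =
    distr (gaussian_measure 0 (S $ i $ i) \<Otimes>\<^sub>M P) borel (\<lambda>(x, \<omega>). x *\<^sub>R regr i + (Z \<omega> - (Z \<omega> $ i) *\<^sub>R regr i))"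
proof -
  define N where "N = gaussian_measure 0 (S $ i $ i)"
  interpret N: prob_space N
    unfolding N_def using v by (intro prob_space_gaussian_measure) simp
  have [measurable_cong]: "sets N = sets borel" by (simp add: N_def)
  interpret NP: pair_prob_space N P ..
  define Y where "Y = (\<lambda>(x, \<omega>). x *\<^sub>R regr i + (Z \<omega> - (Z \<omega> $ i) *\<^sub>R regr i))"
  have [measurable]: "Y \<in> borel_measurable (N \<Otimes>\<^sub>M P)"
    unfolding Y_def by measurable
  have "distr P borel Z = distr (N \<Otimes>\<^sub>M P) borel Y"
  proof (rule char_uniqueness)
    show "prob_space (distr P borel Z)" "prob_space (distr (N \<Otimes>\<^sub>M P) borel Y)"
      by (intro prob_space_distr NP.prob_space_distr; measurable)+
    show "(CLINT x|distr P borel Z. iexp (a \<bullet> x)) = (CLINT x|distr (N \<Otimes>\<^sub>M P) borel Y. iexp (a \<bullet> x))" for a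
    proof -
      define r where "r = a \<bullet> regr i"
      define b where "b = a - r *\<^sub>R axis i 1"
      \<comment> \<open>A linear functional of the recombined vector is \<open>r\<close> times the
        fresh copy \<open>x\<close> plus a linear functional of \<open>Z\<close>, so its
        characteristic function factorises.\<close>
      have Y: "a \<bullet> Y (x, \<omega>) = r * x + b \<bullet> Z \<omega>" for x \<omega>
        by (simp add: Y_def r_def b_def inner_add_right inner_diff_left inner_diff_right inner_axis')
      have "(CLINT x|distr (N \<Otimes>\<^sub>M P) borel Y. iexp (a \<bullet> x)) = (CLINT z|N \<Otimes>\<^sub>M P. iexp (a \<bullet> Y z))"
        by (subst integral_distr) auto
      also have "\<dots> = (CLINT x|N. CLINT \<omega>|P. iexp (a \<bullet> Y (x, \<omega>)))"
        by (rule NP.integral_fst'[symmetric], rule NP.integrable_iexp) auto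
      also have "\<dots> = (CLINT x|N. CLINT \<omega>|P. iexp (r * x) * iexp (b \<bullet> Z \<omega>))"
        by (simp add: Y ring_distribs exp_add)
      also have "\<dots> = (CLINT x|N. iexp (r * x)) * (CLINT \<omega>|P. iexp (b \<bullet> Z \<omega>))"
        by simp
      also have "(CLINT x|N. iexp (r * x)) = of_real (exp (- (S $ i $ i * r\<^sup>2) / 2))"
        using char_gaussian_measure[of "S $ i $ i" r] v by (simp add: N_def char_def)
      also have "(CLINT \<omega>|P. iexp (b \<bullet> Z \<omega>)) = of_real (exp (- (b \<bullet> (S *v b)) / 2))"
        by (rule char_Z)
      also have "of_real (exp (- (S $ i $ i * r\<^sup>2) / 2)) * of_real (exp (- (b \<bullet> (S *v b)) / 2)) =
          complex_of_real (exp (- (S $ i $ i * r\<^sup>2 + b \<bullet> (S *v b)) / 2))"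
        by (simp add: exp_add[symmetric] field_simps flip: of_real_mult)
      \<comment> \<open>The variances of the fitted part and of the residual add up: the cross term
        in \<open>quadratic_diff\<close> is twice \<open>S $ i $ i * r\<^sup>2\<close>.\<close>
      also have "S $ i $ i * r\<^sup>2 + b \<bullet> (S *v b) = a \<bullet> (S *v a)"
      proof -
        have "a \<bullet> (S *v axis i 1) = S $ i $ i * r"
          using v by (simp add: r_def regr_def)
        then show ?thesis
          unfolding b_def quadratic_diff axis_form by (simp add: power2_eq_square)
      qed
      also have "of_real (exp (- (a \<bullet> (S *v a)) / 2)) = (CLINT x|distr P borel Z. iexp (a \<bullet> x))"
        by (subst integral_distr) (auto simp: char_Z)
      finally show ?thesis ..
    qed
  qed auto
  then show ?thesis by (simp add: N_def Y_def)
qed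

text \<open>Fubini applied to \<open>distr_split\<close>: the integrand is the conditional
  probability given that coordinate \<open>i\<close> equals \<open>x\<close>.\<close>

lemma emeasure_split:
  assumes v: "S $ i $ i > 0" and X: "X \<in> sets borel"
  shows "emeasure P {\<omega> \<in> space P. Z \<omega> \<in> X} =
    (\<integral>\<^sup>+x. emeasure P {\<omega> \<in> space P. x *\<^sub>R regr i + (Z \<omega> - (Z \<omega> $ i) *\<^sub>R regr i) \<in> X} \<partial>gaussian_measure 0 (S $ i $ i))"
proof -
  define Y where "Y = (\<lambda>(x, \<omega>). x *\<^sub>R regr i + (Z \<omega> - (Z \<omega> $ i) *\<^sub>R regr i))"
  let ?N = "gaussian_measure 0 (S $ i $ i) \<Otimes>\<^sub>M P"
  have [measurable]: "Y \<in> borel_measurable ?N" "X \<in> sets borel"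
    using X unfolding Y_def by measurable
  have "emeasure P {\<omega> \<in> space P. Z \<omega> \<in> X} = emeasure (distr P borel Z) X"
    using X by (subst emeasure_distr) (auto intro!: arg_cong[where f = "emeasure P"])
  also have "\<dots> = emeasure ?N (Y -` X \<inter> space ?N)"
    using X by (subst distr_split[OF v], fold Y_def, subst emeasure_distr) auto
  also have "\<dots> = (\<integral>\<^sup>+x. emeasure P (Pair x -` (Y -` X \<inter> space ?N)) \<partial>gaussian_measure 0 (S $ i $ i))"
    by (rule emeasure_pair_measure_alt) measurable
  also have "\<dots> = (\<integral>\<^sup>+x. emeasure P {\<omega> \<in> space P. x *\<^sub>R regr i + (Z \<omega> - (Z \<omega> $ i) *\<^sub>R regr i) \<in> X} \<partial>gaussian_measure 0 (S $ i $ i))"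
    by (intro nn_integral_cong arg_cong[where f = "emeasure P"]) (auto simp: space_pair_measure Y_def)
  finally show ?thesis .
qed

lemma coord_sd_eq: "coord_sd P Z i = sqrt (S $ i $ i)"
proof -
  have "(\<integral>\<omega>. (Z \<omega> $ i)\<^sup>2 \<partial>P) = (\<integral>x. x\<^sup>2 \<partial>gaussian_measure 0 (S $ i $ i))"
    by (subst distr_nth[symmetric], subst integral_distr) auto
  also have "\<dots> = S $ i $ i"
  proof (cases "S $ i $ i = 0")
    case True
    then show ?thesis by (simp add: gaussian_measure_def integral_return)
  next
    case False
    with diag_nonneg[of i] have v: "S $ i $ i > 0" by simp
    then show ?thesis
      using integral_normal_moment_even[of "sqrt (S $ i $ i)" 0 1]
      by (simp add: gaussian_measure_def integral_density fact_numeral)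
  qed
  finally show ?thesis by (simp add: coord_sd_def)
qed

end

section \<open>One-sided limits and the Mills ratio\<close>

lemma normal_density_DERIV:
  assumes "\<sigma> > 0"
  shows "(normal_density 0 \<sigma> has_real_derivative - x / \<sigma>\<^sup>2 * normal_density 0 \<sigma> x) (at x)"
  unfolding normal_density_def using assms
  by (auto intro!: derivative_eq_intros simp: field_simps power2_eq_square)

lemma normal_density_at_top:
  assumes "\<sigma> > 0"
  shows "(normal_density 0 \<sigma> \<longlongrightarrow> 0) at_top"
  unfolding normal_density_def using assms by real_asymp

text \<open>The function \<open>F\<close>, which is minus \<open>\<sigma>\<^sup>2 / x\<close> times
  the density, tends to 0 and has as derivative the density times
  \<open>1 + \<sigma>\<^sup>2 / x\<^sup>2\<close>. Integrate over \<open>{s..}\<close>, bound the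
  factor by its value at \<open>s\<close>, and multiply by
  \<open>(s / \<sigma>)\<^sup>2\<close>.\<close>

lemma Mills_ratio_bound:
  assumes \<sigma>: "\<sigma> > 0" and s: "s > 0"
  shows "s * normal_density 0 \<sigma> s \<le>
    ((s / \<sigma>)\<^sup>2 + 1) * measure (density lborel (\<lambda>x. ennreal (normal_density 0 \<sigma> x))) {s<..}"
proof -
  let ?N = "density lborel (\<lambda>x. ennreal (normal_density 0 \<sigma> x))"
  interpret N: prob_space ?N using \<sigma> by (rule prob_space_normal_density)
  define f where "f = (\<lambda>x. (1 + \<sigma>\<^sup>2 / x\<^sup>2) * normal_density 0 \<sigma> x)"
  define F where "F = (\<lambda>x. - (\<sigma>\<^sup>2 / x * normal_density 0 \<sigma> x))"
  have "((\<lambda>x::real. \<sigma>\<^sup>2 / x) \<longlongrightarrow> 0) at_top" by real_asymp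
  then have "(F \<longlongrightarrow> - (0 * 0)) at_top"
    unfolding F_def using normal_density_at_top[OF \<sigma>] by (intro tendsto_intros)
  then have F_lim: "(F \<longlongrightarrow> 0) at_top" by simp
  have F_DERIV: "(F has_real_derivative f x) (at x)" if "s \<le> x" for x
  proof -
    have x: "x > 0" using that s by simp
    have "((\<lambda>x. \<sigma>\<^sup>2 / x) has_real_derivative - (\<sigma>\<^sup>2 / x\<^sup>2)) (at x)"
      using x by (auto intro!: derivative_eq_intros simp: power2_eq_square)
    then show ?thesis
      unfolding F_def f_def using x \<sigma>
      by (auto intro!: derivative_eq_intros normal_density_DERIV simp: field_simps power2_eq_square)
  qed
  have "ennreal (0 - F s) = (\<integral>\<^sup>+x. ennreal (f x) * indicator {s..} x \<partial>lborel)"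
    by (rule sym, rule nn_integral_FTC_atLeast[OF _ F_DERIV _ F_lim]) (auto simp: f_def)
  also have "\<dots> \<le>
      (\<integral>\<^sup>+x. ennreal (1 + (\<sigma> / s)\<^sup>2) * (ennreal (normal_density 0 \<sigma> x) * indicator {s<..} x) \<partial>lborel)"
  proof (rule nn_integral_mono_AE)
    \<comment> \<open>The fundamental theorem gives the closed half-line, the tail is the open one;
      they differ by a null set.\<close>
    have "AE x in lborel. x \<noteq> s"
      by (rule AE_lborel_singleton)
    then show "AE x in lborel. ennreal (f x) * indicator {s..} x \<le>
        ennreal (1 + (\<sigma> / s)\<^sup>2) * (ennreal (normal_density 0 \<sigma> x) * indicator {s<..} x)"
    proof eventually_elim
      case (elim x)
      show ?case
      proof (cases "s < x")
        case True
        have "\<sigma>\<^sup>2 / x\<^sup>2 \<le> (\<sigma> / s)\<^sup>2"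
          unfolding power_divide using True s by (intro divide_left_mono power_mono mult_pos_pos) auto
        then have "f x \<le> (1 + (\<sigma> / s)\<^sup>2) * normal_density 0 \<sigma> x"
          unfolding f_def by (intro mult_right_mono) auto
        then show ?thesis
          using True by (simp del: ennreal_plus flip: ennreal_mult add: ennreal_leI)
      qed (use elim in auto)
    qed
  qed
  also have "\<dots> = ennreal (1 + (\<sigma> / s)\<^sup>2) * emeasure ?N {s<..}"
    by (simp del: ennreal_plus add: nn_integral_cmult emeasure_density)
  also have "\<dots> = ennreal ((1 + (\<sigma> / s)\<^sup>2) * measure ?N {s<..})"
    by (simp del: ennreal_plus add: N.emeasure_eq_measure ennreal_mult)
  finally have "- F s \<le> (1 + (\<sigma> / s)\<^sup>2) * measure ?N {s<..}"
    by (simp del: ennreal_plus add: ennreal_le_iff)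
  then have "(s / \<sigma>)\<^sup>2 * (- F s) \<le> (s / \<sigma>)\<^sup>2 * ((1 + (\<sigma> / s)\<^sup>2) * measure ?N {s<..})"
    by (intro mult_left_mono) auto
  moreover have "(s / \<sigma>)\<^sup>2 * (- F s) = s * normal_density 0 \<sigma> s"
    using s \<sigma> by (simp add: F_def power2_eq_square)
  moreover have "(s / \<sigma>)\<^sup>2 * ((1 + (\<sigma> / s)\<^sup>2) * measure ?N {s<..}) = ((s / \<sigma>)\<^sup>2 + 1) * measure ?N {s<..}"
    using s \<sigma> by (simp add: field_simps)
  ultimately show ?thesis by simp
qed

text \<open>Close to the right of \<open>t\<close> the integrand is within \<open>e / 2\<close> of
  \<open>l\<close>, hence so is its average. The value at \<open>t\<close> itself is arbitrary but
  is attained on a null set only.\<close>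

lemma tendsto_average_right:
  fixes h :: "real \<Rightarrow> real"
  assumes [measurable]: "h \<in> borel_measurable borel"
    and bound: "\<And>s. \<bar>h s\<bar> \<le> C"
    and lim: "(h \<longlongrightarrow> l) (at_right t)"
  shows "((\<lambda>\<delta>. 1 / \<delta> * (\<integral>s. indicator {t..<t + \<delta>} s * h s \<partial>lborel)) \<longlongrightarrow> l) (at_right 0)"
proof (rule tendstoI)
  fix e :: real assume "e > 0"
  have int: "integrable lborel (\<lambda>s. indicator {t..<t + \<delta>} s * g s)"
    if [measurable]: "g \<in> borel_measurable borel" and "\<And>s. \<bar>g s\<bar> \<le> D" for \<delta> D and g :: "real \<Rightarrow> real"
  proof (rule Bochner_Integration.integrable_bound)
    show "integrable lborel (\<lambda>s. D * indicator {t..<t + \<delta>} s)"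
      by (intro integrable_mult_right integrable_real_indicator emeasure_bounded_finite) auto
    have "0 \<le> D" using that(2)[of 0] by linarith
    then show "AE s in lborel. norm (indicator {t..<t + \<delta>} s * g s) \<le> norm (D * indicator {t..<t + \<delta>} s :: real)"
      using that(2) by (auto simp: indicator_def intro: order_trans)
  qed measurable
  obtain d where d: "d > 0" "\<And>s. t < s \<Longrightarrow> s < t + d \<Longrightarrow> \<bar>h s - l\<bar> < e / 2"
    using tendstoD[OF lim, of "e / 2"] \<open>e > 0\<close>
    unfolding eventually_at_right_field dist_real_def
    by (metis add_diff_cancel_left' diff_gt_0_iff_gt half_gt_zero le_add_diff_inverse less_imp_le)
  have "dist (1 / \<delta> * (\<integral>s. indicator {t..<t + \<delta>} s * h s \<partial>lborel)) l < e" if \<delta>: "0 < \<delta>" "\<delta> < d" for \<delta>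
  proof -
    have I: "(\<integral>s. indicator {t..<t + \<delta>} s * c \<partial>lborel) = \<delta> * c" for c :: real
      using \<delta> by simp
    have ih: "integrable lborel (\<lambda>s. indicator {t..<t + \<delta>} s * h s)"
      using bound by (intro int[where D = C]) auto
    have ic: "integrable lborel (\<lambda>s. indicator {t..<t + \<delta>} s * c)" for c :: real
      by (intro int[where D = "\<bar>c\<bar>"]) auto
    have "\<bar>(\<integral>s. indicator {t..<t + \<delta>} s * h s \<partial>lborel) - \<delta> * l\<bar> =
        \<bar>\<integral>s. indicator {t..<t + \<delta>} s * h s - indicator {t..<t + \<delta>} s * l \<partial>lborel\<bar>"
      using ih ic by (subst Bochner_Integration.integral_diff) (auto simp only: I)
    also have "\<dots> \<le> (\<integral>s. \<bar>indicator {t..<t + \<delta>} s * h s - indicator {t..<t + \<delta>} s * l\<bar> \<partial>lborel)"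
      by (rule integral_abs_bound)
    also have "\<dots> \<le> (\<integral>s. indicator {t..<t + \<delta>} s * (e / 2) \<partial>lborel)"
    proof (rule integral_mono_AE)
      have "AE s in lborel. s \<noteq> t"
        by (rule AE_lborel_singleton)
      then show "AE s in lborel. \<bar>indicator {t..<t + \<delta>} s * h s - indicator {t..<t + \<delta>} s * l\<bar> \<le> indicator {t..<t + \<delta>} s * (e / 2)"
      proof eventually_elim
        case (elim s)
        then show ?case
          using d(2)[of s] \<delta> by (auto simp: indicator_def)
      qed
    qed (intro integrable_abs Bochner_Integration.integrable_diff ih ic)+
    also have "\<dots> = \<delta> * (e / 2)" by (rule I)
    finally have le: "\<bar>(\<integral>s. indicator {t..<t + \<delta>} s * h s \<partial>lborel) - \<delta> * l\<bar> \<le> \<delta> * (e / 2)" .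
    have "dist (1 / \<delta> * (\<integral>s. indicator {t..<t + \<delta>} s * h s \<partial>lborel)) l =
        \<bar>((\<integral>s. indicator {t..<t + \<delta>} s * h s \<partial>lborel) - \<delta> * l) / \<delta>\<bar>"
      using \<delta> by (simp add: dist_real_def field_simps)
    also have "\<dots> \<le> e / 2"
      using le \<delta> by (simp add: abs_divide pos_divide_le_eq mult.commute)
    finally show ?thesis using \<open>e > 0\<close> by simp
  qed
  then show "\<forall>\<^sub>F \<delta> in at_right 0. dist (1 / \<delta> * (\<integral>s. indicator {t..<t + \<delta>} s * h s \<partial>lborel)) l < e"
    unfolding eventually_at_right_field using \<open>d > 0\<close> by auto
qed

text \<open>By \<open>stable\<close> the indicators converge pointwise to that of the points
  eventually in \<open>A s\<close>, so dominated convergence applies.\<close>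

lemma (in finite_measure) measure_at_right_limit:
  fixes A :: "real \<Rightarrow> 'a set" and t :: real
  assumes meas: "\<And>s. A s \<in> sets M"
    and stable: "\<And>x. (\<forall>\<^sub>F s in at_right t. x \<in> A s) \<or> (\<forall>\<^sub>F s in at_right t. x \<notin> A s)"
  shows "\<exists>l. ((\<lambda>s. measure M (A s)) \<longlongrightarrow> l) (at_right t)"
proof -
  define C where "C = {x. \<forall>\<^sub>F s in at_right t. x \<in> A s}"
  have ptw: "((\<lambda>s. indicator (A s) x :: real) \<longlongrightarrow> indicator C x) (at_right t)" for x
  proof (cases "x \<in> C")
    case True
    then have "\<forall>\<^sub>F s in at_right t. indicator (A s) x = (1 :: real)"
      unfolding C_def by (auto elim: eventually_mono)
    with True show ?thesis by (simp add: tendsto_eventually)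
  next
    case False
    with stable[of x] have "\<forall>\<^sub>F s in at_right t. indicator (A s) x = (0 :: real)"
      unfolding C_def by (auto elim: eventually_mono)
    with False show ?thesis by (simp add: tendsto_eventually)
  qed
  have "((\<lambda>s. measure M (A s)) \<longlongrightarrow> (\<integral>x. indicator C x \<partial>M)) (at_right t)"
  \<comment> \<open>Passing to sequences also gives measurability of \<open>C\<close>, as its
    indicator is a pointwise limit of measurable ones.\<close>
  proof (rule tendsto_at_right_sequentially[where b = "t + 1"])
    fix S :: "nat \<Rightarrow> real" assume S: "\<And>n. t < S n" "S \<longlonglongrightarrow> t"
    then have "filterlim S (at_right t) sequentially"
      by (auto simp: filterlim_at intro!: always_eventually)
    from filterlim_compose[OF ptw this]
    have lim: "(\<lambda>n. indicator (A (S n)) x :: real) \<longlonglongrightarrow> indicator C x" for x .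
    have [measurable]: "A s \<in> sets M" for s by (rule meas)
    have [measurable]: "(\<lambda>x. indicator C x :: real) \<in> borel_measurable M"
      by (rule borel_measurable_LIMSEQ_real[OF lim]) measurable
    have "(\<lambda>n. \<integral>x. indicator (A (S n)) x \<partial>M) \<longlonglongrightarrow> (\<integral>x. indicator C x \<partial>M :: real)"
    proof (rule integral_dominated_convergence[where w = "\<lambda>_. 1"])
      show "AE x in M. (\<lambda>n. indicator (A (S n)) x :: real) \<longlonglongrightarrow> indicator C x"
        using lim by (rule AE_I2)
      show "AE x in M. norm (indicator (A (S n)) x :: real) \<le> 1" for n
        by (simp add: indicator_def)
    qed measurable
    then show "(\<lambda>n. measure M (A (S n))) \<longlonglongrightarrow> (\<integral>x. indicator C x \<partial>M)"
      using meas by (simp add: sets.Int_space_eq2)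
  qed simp
  then show ?thesis ..
qed

text \<open>A strict inequality at \<open>t\<close>, in either direction, persists nearby by
  continuity; in the case of equality at \<open>t\<close> the sign of \<open>b\<close>
  decides.\<close>

lemma eventually_at_right_stable_le:
  fixes a b t :: real
  shows "(\<forall>\<^sub>F s in at_right t. a \<le> b * s) \<or> (\<forall>\<^sub>F s in at_right t. \<not> a \<le> b * s)"
proof -
  have lim: "((\<lambda>s. b * s) \<longlongrightarrow> b * t) (at_right t)" by (intro tendsto_intros)
  have gt: "\<forall>\<^sub>F s in at_right t. t < s" by (rule eventually_at_right_less)
  consider "a < b * t" | "b * t < a" | "a = b * t" "0 \<le> b" | "a = b * t" "b < 0" by linarith
  then show ?thesis
  proof cases
    case 1
    from order_tendstoD(1)[OF lim 1] show ?thesis by (auto elim: eventually_mono)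
  next
    case 2
    from order_tendstoD(2)[OF lim 2] show ?thesis by (intro disjI2) (auto elim: eventually_mono)
  next
    case 3
    then show ?thesis using gt by (auto elim!: eventually_mono intro: mult_left_mono)
  next
    case 4
    then show ?thesis using gt by (intro disjI2) (auto elim!: eventually_mono)
  qed
qed

lemma eventually_at_right_stable_less:
  fixes a b t :: real
  shows "(\<forall>\<^sub>F s in at_right t. a < b * s) \<or> (\<forall>\<^sub>F s in at_right t. \<not> a < b * s)"
  using eventually_at_right_stable_le[where a = "- a" and b = "- b" and t = t]
  by (auto simp: not_less not_le)

lemma eventually_stable_all_finite:
  fixes Q :: "'i::finite \<Rightarrow> 'b \<Rightarrow> bool"
  assumes "\<And>i. (\<forall>\<^sub>F s in F. Q i s) \<or> (\<forall>\<^sub>F s in F. \<not> Q i s)"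
  shows "(\<forall>\<^sub>F s in F. \<forall>i. Q i s) \<or> (\<forall>\<^sub>F s in F. \<not> (\<forall>i. Q i s))"
proof (cases "\<forall>i. \<forall>\<^sub>F s in F. Q i s")
  case True
  then show ?thesis by (simp add: eventually_all_finite)
next
  case False
  then obtain i where "\<forall>\<^sub>F s in F. \<not> Q i s" using assms by blast
  then show ?thesis by (intro disjI2) (auto elim: eventually_mono)
qed

section \<open>Bounds for weighted sums of \<open>r * std_normal_density r\<close>\<close>

lemma std_normal_density_scaled:
  assumes "\<sigma> > 0"
  shows "s * normal_density 0 \<sigma> s = s / \<sigma> * std_normal_density (s / \<sigma>)"
  using assms by (simp add: normal_density_def real_sqrt_mult power_divide mult_ac)

text \<open>It suffices that \<open>r / u\<close> is at most
  \<open>exp ((r\<^sup>2 - u\<^sup>2) / 2)\<close>. This follows from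
  \<open>1 + y \<le> exp y\<close> at \<open>y = r / u - 1\<close>, because \<open>1 \<le> u\<close>
  gives \<open>(r - u) / u \<le> (r - u) * (r + u) / 2\<close>.\<close>

lemma mult_std_normal_density_antimono:
  assumes "1 \<le> u" "u \<le> r"
  shows "r * std_normal_density r \<le> u * std_normal_density u"
proof -
  have "r / u \<le> exp (r / u - 1)"
    using exp_ge_add_one_self[of "r / u - 1"] by simp
  also have "r / u - 1 = (r - u) / u"
    using assms by (simp add: diff_divide_distrib)
  also have "(r - u) / u \<le> (r - u) / 1"
    using assms by (intro divide_left_mono) auto
  also have "\<dots> = (r - u) * 1" by simp
  also have "\<dots> \<le> (r - u) * ((r + u) / 2)"
    using assms by (intro mult_left_mono) auto
  also have "(r - u) * ((r + u) / 2) = r\<^sup>2 / 2 - u\<^sup>2 / 2"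
    by (simp add: power2_eq_square field_simps)
  finally have "u * exp (- (r\<^sup>2 / 2)) * (r / u) \<le> u * exp (- (r\<^sup>2 / 2)) * exp (r\<^sup>2 / 2 - u\<^sup>2 / 2)"
    using assms by (intro mult_left_mono) auto
  then have "r * exp (- (r\<^sup>2 / 2)) \<le> u * exp (- (u\<^sup>2 / 2))"
    using assms by (simp add: mult.assoc mult.commute[of r] flip: exp_add)
  then show ?thesis
    by (simp add: std_normal_density_def divide_right_mono)
qed

lemma inverse_sqrt_2pi_le: "1 / sqrt (2 * pi) \<le> 41 / 100"
proof -
  \<comment> \<open>The square is below 6, so \<open>pi > 3\<close> is precise enough.\<close>
  have "(100 / 41)\<^sup>2 \<le> 2 * pi"
    using pi_gt3 by (simp add: power2_eq_square)
  then have "100 / 41 \<le> sqrt (2 * pi)"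
    by (rule real_le_rsqrt)
  then show ?thesis by (simp add: field_simps)
qed

lemma one_le_ln:
  assumes "3 \<le> (p :: real)"
  shows "1 \<le> ln p"
  using assms exp_le by (subst ln_ge_iff) auto

text \<open>Terms with \<open>r i \<le> u\<close> are bounded by \<open>Mills\<close> and add up to
  at most \<open>u\<^sup>2 + 1\<close> by \<open>total\<close>. Each other term is at most
  \<open>u * std_normal_density u\<close>; there are at most \<open>x\<close> of them, and the
  choice of \<open>u\<close> makes \<open>exp (- u\<^sup>2 / 2)\<close> equal to
  \<open>1 / x\<close>, which cancels their number.\<close>

lemma sum_split_threshold:
  assumes u: "1 \<le> u"
    and nonneg: "\<And>i. i \<in> J \<Longrightarrow> 0 \<le> r i \<and> 0 \<le> g i \<and> g i \<le> 1 \<and> 0 \<le> q i"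
    and Mills: "\<And>i. i \<in> J \<Longrightarrow> r i * std_normal_density (r i) \<le> ((r i)\<^sup>2 + 1) * q i"
    and total: "(\<Sum>i\<in>J. q i * g i) \<le> 1"
    and x: "real (card J) \<le> x" "u\<^sup>2 = 2 * ln x" "0 < x"
  shows "(\<Sum>i\<in>J. r i * std_normal_density (r i) * g i) \<le> u\<^sup>2 + 1 + u * (41 / 100)"
proof -
  have "r i * std_normal_density (r i) * g i \<le> (u\<^sup>2 + 1) * (q i * g i) + u * std_normal_density u" if i: "i \<in> J" for i
  proof (cases "r i \<le> u")
    case True
    then have "(r i)\<^sup>2 + 1 \<le> u\<^sup>2 + 1"
      using nonneg[OF i] by (simp add: power_mono)
    then have "((r i)\<^sup>2 + 1) * q i \<le> (u\<^sup>2 + 1) * q i"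
      using nonneg[OF i] by (intro mult_right_mono) auto
    with Mills[OF i] have "r i * std_normal_density (r i) * g i \<le> (u\<^sup>2 + 1) * q i * g i"
      using nonneg[OF i] by (intro mult_right_mono) auto
    moreover have "0 \<le> u * std_normal_density u" using u by simp
    ultimately show ?thesis by (simp add: mult.assoc)
  next
    case False
    then have "r i * std_normal_density (r i) * g i \<le> u * std_normal_density u * 1"
      using nonneg[OF i] u by (intro mult_mono mult_std_normal_density_antimono) auto
    moreover have "0 \<le> (u\<^sup>2 + 1) * (q i * g i)" using nonneg[OF i] by simp
    ultimately show ?thesis by simp
  qed
  then have "(\<Sum>i\<in>J. r i * std_normal_density (r i) * g i) \<le>
      (\<Sum>i\<in>J. (u\<^sup>2 + 1) * (q i * g i) + u * std_normal_density u)"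
    by (rule sum_mono)
  also have "\<dots> = (u\<^sup>2 + 1) * (\<Sum>i\<in>J. q i * g i) + real (card J) * (u * std_normal_density u)"
    by (simp add: sum.distrib sum_distrib_left)
  also have "\<dots> \<le> (u\<^sup>2 + 1) * 1 + x * (u * std_normal_density u)"
    using total x(1) u by (intro add_mono mult_left_mono mult_right_mono) auto
  also have "x * (u * std_normal_density u) = u * (1 / sqrt (2 * pi))"
    using x by (simp add: std_normal_density_def exp_minus)
  also have "\<dots> \<le> u * (41 / 100)"
    using u by (intro mult_left_mono inverse_sqrt_2pi_le) auto
  finally show ?thesis by simp
qed

lemma le_sq_plus_one_half: "x \<le> (x\<^sup>2 + 1) / (2 :: real)"
proof -
  have "0 \<le> (x - 1)\<^sup>2" by simp
  then show ?thesis by (simp add: power2_diff)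
qed

text \<open>The threshold \<open>R\<close> is chosen so that \<open>exp (- R\<^sup>2 / 2)\<close> is
  \<open>1 / (p * ln p)\<close>: the factor \<open>p\<close> cancels the number of terms, and
  \<open>ln p\<close> pays for the factor \<open>R\<close>, which is at most
  \<open>sqrt 2 * ln p\<close>. What remains is \<open>sqrt 2 / sqrt (2 * pi)\<close>.\<close>

lemma sum_tails_le:
  assumes p: "3 \<le> p" and J: "real (card J) \<le> p"
    and R: "R = sqrt (2 * ln p + 2 * ln (ln p))"
    and g: "\<And>i. i \<in> J \<Longrightarrow> R \<le> r i \<and> 0 \<le> g i \<and> g i \<le> 1"
  shows "(\<Sum>i\<in>J. r i * std_normal_density (r i) * g i) \<le> 58 / 100"
proof -
  define l where "l = ln p"
  have l: "1 \<le> l" unfolding l_def using p by (rule one_le_ln)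
  have ln_l: "0 \<le> ln l" "ln l \<le> l - 1"
    using l ln_le_minus_one[of l] by auto
  have R2: "R\<^sup>2 = 2 * l + 2 * ln l"
    unfolding R l_def[symmetric] using l ln_l by simp
  have R1: "1 \<le> R"
    unfolding R l_def[symmetric] using l ln_l by (intro real_le_rsqrt) simp
  have "R \<le> sqrt 2 * l"
  proof (rule power2_le_imp_le)
    have "0 \<le> (l - 1)\<^sup>2" by simp
    then have "2 * l + 2 * (l - 1) \<le> 2 * l\<^sup>2" by (simp add: power2_diff)
    then show "R\<^sup>2 \<le> (sqrt 2 * l)\<^sup>2"
      unfolding R2 using ln_l by (simp add: power_mult_distrib)
  qed (use l in simp)
  moreover have "p * std_normal_density R = 1 / sqrt (2 * pi) / l"
  proof -
    have "exp (- R\<^sup>2 / 2) = exp (- l - ln l)"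
      unfolding R2 by (simp add: field_simps)
    also have "\<dots> = 1 / (p * l)"
      using l p by (simp add: exp_diff exp_minus l_def field_simps)
    finally show ?thesis
      using p by (simp add: std_normal_density_def)
  qed
  ultimately have "p * (R * std_normal_density R) \<le> (sqrt 2 * l) * (1 / sqrt (2 * pi) / l)"
    unfolding mult.left_commute[of p] using l by (simp only:) (intro mult_right_mono, auto)
  also have "\<dots> = sqrt 2 * (1 / sqrt (2 * pi))"
    using l by simp
  also have "\<dots> \<le> sqrt 2 * (41 / 100)"
    by (intro mult_left_mono inverse_sqrt_2pi_le) auto
  also have "\<dots> \<le> 58 / 100"
  proof -
    have "sqrt 2 \<le> 58 / 41" by (rule real_le_lsqrt) (auto simp: power2_eq_square)
    then show ?thesis by simp
  qed
  finally have *: "p * (R * std_normal_density R) \<le> 58 / 100" .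
  have "(\<Sum>i\<in>J. r i * std_normal_density (r i) * g i) \<le> (\<Sum>i\<in>J. R * std_normal_density R * 1)"
  proof (rule sum_mono)
    fix i assume "i \<in> J"
    from g[OF this] R1 show "r i * std_normal_density (r i) * g i \<le> R * std_normal_density R * 1"
      by (intro mult_mono mult_std_normal_density_antimono) auto
  qed
  also have "\<dots> \<le> p * (R * std_normal_density R)"
    using J R1 by (auto intro!: mult_right_mono)
  finally show ?thesis using * by simp
qed

text \<open>For the first bound, \<open>J\<close> is treated with threshold
  \<open>sqrt (2 * ln m)\<close> and its complement by \<open>sum_tails_le\<close>. For the second,
  all of \<open>I\<close> is treated with threshold \<open>sqrt (2 * ln p)\<close>.\<close>

lemma sum_le_ln_bounds:
  fixes r g q :: "'i \<Rightarrow> real"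
  assumes I: "finite I" "real (card I) \<le> p" and p: "3 \<le> p"
    and nonneg: "\<And>i. i \<in> I \<Longrightarrow> 0 \<le> r i \<and> 0 \<le> g i \<and> g i \<le> 1 \<and> 0 \<le> q i"
    and Mills: "\<And>i. i \<in> I \<Longrightarrow> r i * std_normal_density (r i) \<le> ((r i)\<^sup>2 + 1) * q i"
    and total: "(\<Sum>i\<in>I. q i * g i) \<le> 1"
    and m: "real (card {i \<in> I. r i \<le> sqrt (2 * ln p + 2 * ln (ln p))}) \<le> m" "2 \<le> m"
  shows "(\<Sum>i\<in>I. r i * std_normal_density (r i) * g i) \<le> 4 * ln m + 1"
    and "(\<Sum>i\<in>I. r i * std_normal_density (r i) * g i) \<le> 4 * ln p"
proof -
  define R where "R = sqrt (2 * ln p + 2 * ln (ln p))"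
  define J where "J = {i \<in> I. r i \<le> R}"
  \<comment> \<open>Here \<open>m \<ge> 2\<close> enters: it makes \<open>u \<ge> 1\<close> and
    leaves room for the additive constants.\<close>
  have "2 / 3 \<le> ln (2 :: real)" by (rule ln2_ge_two_thirds)
  also have "\<dots> \<le> ln m" using m by simp
  finally have ln_m: "2 / 3 \<le> ln m" .
  have total_J: "(\<Sum>i\<in>J. q i * g i) \<le> 1"
    by (rule order_trans[OF sum_mono2 total]) (use I nonneg in \<open>auto simp: J_def\<close>)
  define u where "u = sqrt (2 * ln m)"
  have u2: "u\<^sup>2 = 2 * ln m" using ln_m by (simp add: u_def)
  have "(\<Sum>i\<in>I. r i * std_normal_density (r i) * g i) =
      (\<Sum>i\<in>I - J. r i * std_normal_density (r i) * g i) + (\<Sum>i\<in>J. r i * std_normal_density (r i) * g i)"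
    using I by (intro sum.subset_diff) (auto simp: J_def)
  moreover have "(\<Sum>i\<in>I - J. r i * std_normal_density (r i) * g i) \<le> 58 / 100"
  proof (rule sum_tails_le[OF p _ R_def])
    have "card (I - J) \<le> card I" using I by (intro card_mono) auto
    then show "real (card (I - J)) \<le> p" using I by simp
  qed (use nonneg in \<open>auto simp: J_def\<close>)
  moreover have "(\<Sum>i\<in>J. r i * std_normal_density (r i) * g i) \<le>
      u\<^sup>2 + 1 + u * (41 / 100)"
  proof (rule sum_split_threshold[where q = q and x = m])
    show "1 \<le> u" unfolding u_def using ln_m by (intro real_le_rsqrt) simp
    show "real (card J) \<le> m" using m by (simp add: J_def R_def)
  qed (use ln_m u2 m nonneg Mills total_J in \<open>auto simp: J_def\<close>)
  \<comment> \<open>With \<open>u \<le> (u\<^sup>2 + 1) / 2\<close> the total is at most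
    \<open>2.41 * ln m + 1.785\<close>, which is below the claim once
    \<open>ln m \<ge> 1 / 2\<close>.\<close>
  moreover have "X \<le> 4 * ln m + 1" if "X = A + B" "A \<le> 58 / 100" "B \<le> u\<^sup>2 + 1 + u * (41 / 100)" for X A B :: real
    using that ln_m u2 le_sq_plus_one_half[of u] by argo
  ultimately show "(\<Sum>i\<in>I. r i * std_normal_density (r i) * g i) \<le> 4 * ln m + 1"
    by blast
  have ln_p: "1 \<le> ln p" using p by (rule one_le_ln)
  have "(\<Sum>i\<in>I. r i * std_normal_density (r i) * g i) \<le>
      (sqrt (2 * ln p))\<^sup>2 + 1 + sqrt (2 * ln p) * (41 / 100)"
  proof (rule sum_split_threshold[where q = q and x = p])
    show "1 \<le> sqrt (2 * ln p)" using ln_p by (intro real_le_rsqrt) simp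
  qed (use ln_p p I nonneg Mills total in auto)
  \<comment> \<open>The right-hand side is \<open>2.41 * ln p + 1.205\<close>, and
    \<open>ln p \<ge> 1\<close> absorbs the constant.\<close>
  also have "\<dots> \<le> 2 * ln p + 1 + (2 * ln p + 1) / 2 * (41 / 100)"
    using le_sq_plus_one_half[of "sqrt (2 * ln p)"] ln_p by simp
  also have "\<dots> \<le> 4 * ln p" using ln_p by (simp add: field_simps)
  finally show "(\<Sum>i\<in>I. r i * std_normal_density (r i) * g i) \<le> 4 * ln p" .
qed

section \<open>The density of the maximum\<close>

text \<open>
  The injection \<open>idx\<close> breaks ties between coordinates attaining the maximum: the first one counts.
\<close>

definition peaks_at :: "('n \<Rightarrow> nat) \<Rightarrow> 'n \<Rightarrow> real \<Rightarrow> (real^'n) set" where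
  "peaks_at idx i s = {z. \<forall>j. z $ j \<le> s \<and> (idx j < idx i \<longrightarrow> z $ j < s)}"

definition first_argmax :: "('n \<Rightarrow> nat) \<Rightarrow> 'n \<Rightarrow> real set \<Rightarrow> (real^'n) set" where
  "first_argmax idx i I = {z. z $ i \<in> I \<and> z \<in> peaks_at idx i (z $ i)}"

lemma first_argmax_disjoint:
  assumes "inj idx" "z \<in> first_argmax idx i I" "z \<in> first_argmax idx k I"
  shows "i = k"
proof -
  have le: "z $ i \<le> z $ k" "z $ k \<le> z $ i"
    using assms(2,3) by (auto simp: first_argmax_def peaks_at_def)
  have "idx i < idx k \<longrightarrow> z $ i < z $ k" "idx k < idx i \<longrightarrow> z $ k < z $ i"
    using assms(2,3) by (auto simp: first_argmax_def peaks_at_def)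
  with le have "idx i = idx k" by (meson leD nat_neq_iff)
  then show ?thesis using \<open>inj idx\<close> by (simp add: inj_eq)
qed

lemma Max_in_iff_first_argmax:
  fixes z :: "real^'n"
  shows "(MAX j. z $ j) \<in> I \<longleftrightarrow> (\<exists>i. z \<in> first_argmax idx i I)"
proof
  assume M: "(MAX j. z $ j) \<in> I"
  have "(MAX j. z $ j) \<in> range (($) z)" by (rule Max_in) auto
  then obtain i0 where "z $ i0 = (MAX j. z $ j)" by (metis rangeE)
  \<comment> \<open>Among the maximising coordinates take the one of least index.\<close>
  from ex_has_least_nat[of "\<lambda>i. z $ i = (MAX j. z $ j)", OF this, of idx]
  obtain i where i: "z $ i = (MAX j. z $ j)" and least: "\<And>j. z $ j = (MAX j. z $ j) \<Longrightarrow> idx i \<le> idx j"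
    by auto
  have le: "z $ j \<le> z $ i" for j unfolding i by (rule Max_ge) auto
  moreover have "z $ j < z $ i" if "idx j < idx i" for j
    using le[of j] least[of j] that i by (metis leD le_less)
  ultimately have "z \<in> first_argmax idx i I"
    using M i by (auto simp: first_argmax_def peaks_at_def)
  then show "\<exists>i. z \<in> first_argmax idx i I" ..
next
  assume "\<exists>i. z \<in> first_argmax idx i I"
  then obtain i where i: "z $ i \<in> I" "\<And>j. z $ j \<le> z $ i"
    by (auto simp: first_argmax_def peaks_at_def)
  then have "(MAX j. z $ j) = z $ i" by (intro Max_eqI) auto
  with i show "(MAX j. z $ j) \<in> I" by simp
qed

lemma first_argmax_borel [measurable]:
  fixes idx :: "'n::finite \<Rightarrow> nat"
  assumes [measurable]: "I \<in> sets borel"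
  shows "first_argmax idx i I \<in> sets borel"
  unfolding first_argmax_def peaks_at_def by measurable

context centered_gaussian
begin

text \<open>
  The conditional probability, given \<open>Z\<^sub>i = s\<close>, that \<open>i\<close> is the first coordinate attaining the maximum.
\<close>

definition face_prob :: "('n \<Rightarrow> nat) \<Rightarrow> 'n \<Rightarrow> real \<Rightarrow> real" where
  "face_prob idx i s = measure P {\<omega> \<in> space P. s *\<^sub>R regr i + (Z \<omega> - (Z \<omega> $ i) *\<^sub>R regr i) \<in> peaks_at idx i s}"

lemma face_prob_nonneg: "0 \<le> face_prob idx i s"
  by (simp add: face_prob_def)

lemma face_prob_le_1: "face_prob idx i s \<le> 1"
  by (simp add: face_prob_def)

lemma face_prob_measurable [measurable]: "face_prob idx i \<in> borel_measurable borel"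
proof -
  define Q where "Q = {x \<in> space (borel \<Otimes>\<^sub>M P).
    fst x *\<^sub>R regr i + (Z (snd x) - (Z (snd x) $ i) *\<^sub>R regr i) \<in> peaks_at idx i (fst x)}"
  have "Q \<in> sets (borel \<Otimes>\<^sub>M P)"
    unfolding Q_def peaks_at_def mem_Collect_eq by measurable
  then have "(\<lambda>s. enn2real (emeasure P (Pair s -` Q))) \<in> borel_measurable borel"
    by (intro measurable_compose[OF measurable_emeasure_Pair]) auto
  moreover have "enn2real (emeasure P (Pair s -` Q)) = face_prob idx i s" for s
    unfolding face_prob_def measure_def Q_def
    by (intro arg_cong[where f = "\<lambda>A. enn2real (emeasure P A)"]) (auto simp: space_pair_measure)
  ultimately show ?thesis by (simp cong: measurable_cong)
qed

text \<open>For a fixed outcome with residual \<open>w\<close>, membership says that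
  \<open>w $ j\<close> is at most, or strictly below, \<open>(1 - regr i $ j) * s\<close> for each
  \<open>j\<close>. These finitely many conditions are each eventually constant as \<open>s\<close>
  decreases to \<open>t\<close>.\<close>

lemma face_prob_at_right: "\<exists>l. (face_prob idx i \<longlongrightarrow> l) (at_right t)"
  unfolding face_prob_def
proof (rule measure_at_right_limit)
  let ?A = "\<lambda>s. {\<omega> \<in> space P. s *\<^sub>R regr i + (Z \<omega> - (Z \<omega> $ i) *\<^sub>R regr i) \<in> peaks_at idx i s}"
  show "?A s \<in> sets P" for s
    unfolding peaks_at_def mem_Collect_eq by measurable
  show "(\<forall>\<^sub>F s in at_right t. \<omega> \<in> ?A s) \<or> (\<forall>\<^sub>F s in at_right t. \<omega> \<notin> ?A s)" for \<omega>
  proof (cases "\<omega> \<in> space P")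
    case True
    define w where "w = Z \<omega> - (Z \<omega> $ i) *\<^sub>R regr i"
    define B where "B j s \<longleftrightarrow> (if idx j < idx i then w $ j < (1 - regr i $ j) * s else w $ j \<le> (1 - regr i $ j) * s)" for j s
    have "(s *\<^sub>R regr i + w) $ j \<le> s \<and> (idx j < idx i \<longrightarrow> (s *\<^sub>R regr i + w) $ j < s) \<longleftrightarrow> B j s" for s j
    proof -
      have "(1 - regr i $ j) * s = s - s * regr i $ j" by (simp add: algebra_simps)
      then show ?thesis by (auto simp: B_def)
    qed
    then have "\<omega> \<in> ?A s \<longleftrightarrow> (\<forall>j. B j s)" for s
      using True unfolding w_def[symmetric] peaks_at_def mem_Collect_eq by simp
    moreover have "(\<forall>\<^sub>F s in at_right t. \<forall>j. B j s) \<or> (\<forall>\<^sub>F s in at_right t. \<not> (\<forall>j. B j s))"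
    proof (rule eventually_stable_all_finite)
      show "(\<forall>\<^sub>F s in at_right t. B j s) \<or> (\<forall>\<^sub>F s in at_right t. \<not> B j s)" for j
        unfolding B_def
        by (cases "idx j < idx i")
           (simp_all only: if_True if_False eventually_at_right_stable_less eventually_at_right_stable_le)
    qed
    ultimately show ?thesis by simp
  qed simp
qed

lemma regr_self: "S $ i $ i > 0 \<Longrightarrow> regr i $ i = 1"
  by (simp add: regr_nth)

text \<open>Condition on coordinate \<open>i\<close>. Since \<open>regr i $ i = 1\<close>, the
  recombined vector has coordinate \<open>i\<close> equal to the value \<open>s\<close> conditioned
  on, so the conditional probability is \<open>face_prob idx i s\<close> for \<open>s\<close> in
  \<open>I\<close> and 0 otherwise.\<close>

lemma measure_first_argmax:
  assumes v: "S $ i $ i > 0" and [measurable]: "I \<in> sets borel"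
  shows "measure P {\<omega> \<in> space P. Z \<omega> \<in> first_argmax idx i I} =
    (\<integral>s. indicator I s * (normal_density 0 (sqrt (S $ i $ i)) s * face_prob idx i s) \<partial>lborel)"
proof -
  let ?N = "gaussian_measure 0 (S $ i $ i)"
  have "emeasure P {\<omega> \<in> space P. Z \<omega> \<in> first_argmax idx i I} =
      (\<integral>\<^sup>+s. ennreal (indicator I s * face_prob idx i s) \<partial>?N)"
    unfolding emeasure_split[OF v first_argmax_borel[OF assms(2)]]
  proof (rule nn_integral_cong)
    fix s
    have "{\<omega> \<in> space P. s *\<^sub>R regr i + (Z \<omega> - (Z \<omega> $ i) *\<^sub>R regr i) \<in> first_argmax idx i I} =
      (if s \<in> I then {\<omega> \<in> space P. s *\<^sub>R regr i + (Z \<omega> - (Z \<omega> $ i) *\<^sub>R regr i) \<in> peaks_at idx i s} else {})"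
      using regr_self[OF v] by (auto simp: first_argmax_def)
    then show "emeasure P {\<omega> \<in> space P. s *\<^sub>R regr i + (Z \<omega> - (Z \<omega> $ i) *\<^sub>R regr i) \<in> first_argmax idx i I} =
        ennreal (indicator I s * face_prob idx i s)"
      by (simp add: face_prob_def emeasure_eq_measure)
  qed
  also have "\<dots> = (\<integral>\<^sup>+s. ennreal (normal_density 0 (sqrt (S $ i $ i)) s) * ennreal (indicator I s * face_prob idx i s) \<partial>lborel)"
    using v by (simp add: gaussian_measure_def nn_integral_density)
  also have "\<dots> = (\<integral>\<^sup>+s. ennreal (indicator I s * (normal_density 0 (sqrt (S $ i $ i)) s * face_prob idx i s)) \<partial>lborel)"
    by (intro nn_integral_cong) (simp add: face_prob_nonneg mult_ac flip: ennreal_mult)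
  finally show ?thesis
    by (simp add: measure_def integral_eq_nn_integral face_prob_nonneg)
qed

text \<open>The coordinate is almost surely 0, which lies outside \<open>I\<close>. Positivity of
  \<open>t\<close> ensures \<open>0 \<notin> I\<close> in the application.\<close>

lemma measure_first_argmax_degenerate:
  assumes "S $ i $ i = 0" "0 \<notin> I" and [measurable]: "I \<in> sets borel"
  shows "measure P {\<omega> \<in> space P. Z \<omega> \<in> first_argmax idx i I} = 0"
proof -
  have "measure P {\<omega> \<in> space P. Z \<omega> \<in> first_argmax idx i I} \<le> measure P {\<omega> \<in> space P. Z \<omega> $ i \<in> I}"
    by (rule finite_measure_mono) (auto simp: first_argmax_def)
  also have "\<dots> = measure (distr P borel (\<lambda>\<omega>. Z \<omega> $ i)) I"
    by (subst measure_distr) (auto intro!: arg_cong[where f = "measure P"])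
  also have "\<dots> = 0"
    using assms by (simp add: distr_nth gaussian_measure_def measure_return)
  finally show ?thesis by (simp add: measure_le_0_iff)
qed

section \<open>Disjoint strips over the faces\<close>

text \<open>
  The points beyond the face \<open>z\<^sub>i = s\<close> of the polyhedron \<open>max z \<le> s\<close> that project into this face along
  its normal, where orthogonality is meant with respect to the covariance.
\<close>

definition normal_strip :: "('n \<Rightarrow> nat) \<Rightarrow> 'n \<Rightarrow> real \<Rightarrow> (real^'n) set" where
  "normal_strip idx i s = {z. s < z $ i \<and> z - (z $ i - s) *\<^sub>R regr i \<in> peaks_at idx i s}"

lemma normal_strip_borel [measurable]: "normal_strip idx i s \<in> sets borel"
  unfolding normal_strip_def peaks_at_def mem_Collect_eq by measurable

text \<open>Let \<open>a\<close> and \<open>b\<close> be the heights of \<open>z\<close> above the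
  two faces. The face conditions give \<open>b * S $ i $ i \<le> a * S $ i $ k\<close> and
  \<open>a * S $ k $ k < b * S $ i $ k\<close>, whose product contradicts Cauchy-Schwarz. The
  strictness comes from tie-breaking and is essential, since a singular covariance allows equality
  in Cauchy-Schwarz.\<close>

lemma normal_strip_disjoint_less:
  assumes v: "S $ i $ i > 0" "S $ k $ k > 0" and "idx i < idx k"
    and z: "z \<in> normal_strip idx i s" "z \<in> normal_strip idx k s"
  shows False
proof -
  define a b where "a = z $ i - s" and "b = z $ k - s"
  have ab: "a > 0" "b > 0" using z by (auto simp: normal_strip_def a_def b_def)
  have "z $ k - a * regr i $ k \<le> s"
    using z(1) by (simp add: normal_strip_def peaks_at_def a_def)
  then have 1: "b * S $ i $ i \<le> a * S $ i $ k"
    using v by (simp add: b_def regr_nth symmetric_entry[of k i] field_simps)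
  have "z $ i - b * regr k $ i < s"
    using z(2) assms(3) by (simp add: normal_strip_def peaks_at_def b_def)
  then have 2: "a * S $ k $ k < b * S $ i $ k"
    using v by (simp add: a_def regr_nth field_simps)
  have "0 < b * S $ i $ k" using 2 ab v by (smt (verit) mult_pos_pos)
  then have "(a * S $ k $ k) * (b * S $ i $ i) < (b * S $ i $ k) * (a * S $ i $ k)"
    using ab v by (intro mult_less_le_imp_less[OF 2 1]) auto
  then have "(a * b) * (S $ i $ i * S $ k $ k) < (a * b) * (S $ i $ k)\<^sup>2"
    by (simp add: power2_eq_square mult_ac)
  then have "S $ i $ i * S $ k $ k < (S $ i $ k)\<^sup>2"
    using ab by (simp add: mult_less_cancel_left_pos)
  with Cauchy_Schwarz_entry[OF v(1), of k] show False by simp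
qed

text \<open>Given that coordinate \<open>i\<close> equals \<open>x\<close>, subtracting
  \<open>(x - s) *\<^sub>R regr i\<close> moves the vector to its version with value
  \<open>s\<close>. The face condition is then free of \<open>x\<close>, so the integral is a
  product.\<close>

lemma measure_normal_strip:
  assumes v: "S $ i $ i > 0"
  shows "measure P {\<omega> \<in> space P. Z \<omega> \<in> normal_strip idx i s} =
    measure (gaussian_measure 0 (S $ i $ i)) {s<..} * face_prob idx i s"
proof -
  let ?N = "gaussian_measure 0 (S $ i $ i)"
  interpret N: prob_space ?N using v by (intro prob_space_gaussian_measure) simp
  have "emeasure P {\<omega> \<in> space P. Z \<omega> \<in> normal_strip idx i s} =
      (\<integral>\<^sup>+x. ennreal (face_prob idx i s) * indicator {s<..} x \<partial>?N)"
    unfolding emeasure_split[OF v normal_strip_borel]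
  proof (rule nn_integral_cong)
    fix x
    have "{\<omega> \<in> space P. x *\<^sub>R regr i + (Z \<omega> - (Z \<omega> $ i) *\<^sub>R regr i) \<in> normal_strip idx i s} =
      (if s < x then {\<omega> \<in> space P. s *\<^sub>R regr i + (Z \<omega> - (Z \<omega> $ i) *\<^sub>R regr i) \<in> peaks_at idx i s} else {})"
      using regr_self[OF v] by (auto simp: normal_strip_def algebra_simps)
    then show "emeasure P {\<omega> \<in> space P. x *\<^sub>R regr i + (Z \<omega> - (Z \<omega> $ i) *\<^sub>R regr i) \<in> normal_strip idx i s} =
        ennreal (face_prob idx i s) * indicator {s<..} x"
      by (simp add: face_prob_def emeasure_eq_measure)
  qed
  also have "\<dots> = ennreal (face_prob idx i s) * emeasure ?N {s<..}"
    by (subst nn_integral_cmult_indicator) auto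
  also have "\<dots> = ennreal (measure ?N {s<..} * face_prob idx i s)"
    by (simp add: N.emeasure_eq_measure ennreal_mult face_prob_nonneg mult.commute)
  finally show ?thesis by (simp add: measure_def face_prob_nonneg)
qed

lemma sum_normal_strips_le_1:
  assumes "inj idx"
  shows "(\<Sum>i | S $ i $ i > 0. measure (gaussian_measure 0 (S $ i $ i)) {s<..} * face_prob idx i s) \<le> 1"
proof -
  let ?A = "\<lambda>i. {\<omega> \<in> space P. Z \<omega> \<in> normal_strip idx i s}"
  have disj: "disjoint_family_on ?A {i. S $ i $ i > 0}"
  proof (unfold disjoint_family_on_def, intro ballI impI)
    fix i k assume ik: "i \<in> {i. S $ i $ i > 0}" "k \<in> {i. S $ i $ i > 0}" "i \<noteq> k"
    then have "idx i < idx k \<or> idx k < idx i"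
      using \<open>inj idx\<close> by (metis injD linorder_neqE_nat)
    with ik show "?A i \<inter> ?A k = {}"
      using normal_strip_disjoint_less[of i k idx] normal_strip_disjoint_less[of k i idx] by auto
  qed
  have "(\<Sum>i | S $ i $ i > 0. measure (gaussian_measure 0 (S $ i $ i)) {s<..} * face_prob idx i s) =
      (\<Sum>i | S $ i $ i > 0. measure P (?A i))"
    by (intro sum.cong) (auto simp: measure_normal_strip)
  also have "\<dots> = measure P (\<Union>i\<in>{i. S $ i $ i > 0}. ?A i)"
    using disj by (intro finite_measure_finite_Union[symmetric]) auto
  also have "\<dots> \<le> 1" by simp
  finally show ?thesis .
qed

section \<open>Assembling the density of the maximum and its bounds\<close>

lemma measure_Max:
  assumes "inj idx" "0 \<notin> I" and I [measurable]: "I \<in> sets borel"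
  shows "measure P {\<omega> \<in> space P. (MAX i. Z \<omega> $ i) \<in> I} =
    (\<Sum>i | S $ i $ i > 0. \<integral>s. indicator I s * (normal_density 0 (sqrt (S $ i $ i)) s * face_prob idx i s) \<partial>lborel)"
proof -
  let ?A = "\<lambda>i. {\<omega> \<in> space P. Z \<omega> \<in> first_argmax idx i I}"
  have "{\<omega> \<in> space P. (MAX i. Z \<omega> $ i) \<in> I} = (\<Union>i. ?A i)"
    unfolding Max_in_iff_first_argmax[where idx = idx] by auto
  also have "measure P \<dots> = (\<Sum>i\<in>UNIV. measure P (?A i))"
    using first_argmax_disjoint[OF \<open>inj idx\<close>]
    by (intro finite_measure_finite_Union) (auto simp: disjoint_family_on_def)
  also have "\<dots> = (\<Sum>i | S $ i $ i > 0. measure P (?A i))"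
  proof (rule sum.mono_neutral_right)
    show "\<forall>i\<in>UNIV - {i. S $ i $ i > 0}. measure P (?A i) = 0"
    proof
      fix i assume "i \<in> UNIV - {i. S $ i $ i > 0}"
      then have "S $ i $ i = 0" using diag_nonneg[of i] by simp
      then show "measure P (?A i) = 0"
        using assms(2) I by (rule measure_first_argmax_degenerate)
    qed
  qed auto
  also have "\<dots> = (\<Sum>i | S $ i $ i > 0. \<integral>s. indicator I s * (normal_density 0 (sqrt (S $ i $ i)) s * face_prob idx i s) \<partial>lborel)"
    by (intro sum.cong refl measure_first_argmax) auto
  finally show ?thesis .
qed

text \<open>Rewrites the defining condition in terms of the ratio \<open>t / \<sigma>\<close>.
  Coordinates of variance zero are not counted because \<open>t > 0\<close>, and
  \<open>p \<ge> 3\<close> makes the radicand positive.\<close>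

lemma effective_dim_eq:
  assumes p: "CARD('n) \<ge> 3" and t: "t > 0"
  shows "effective_dim P Z t = max (card {i. S $ i $ i > 0 \<and>
    t / sqrt (S $ i $ i) \<le> sqrt (2 * ln (real CARD('n)) + 2 * ln (ln (real CARD('n))))}) 2"
proof -
  define R where "R = sqrt (2 * ln (real CARD('n)) + 2 * ln (ln (real CARD('n))))"
  have "1 \<le> ln (real CARD('n))" using p by (intro one_le_ln) simp
  then have pos: "0 < 2 * ln (real CARD('n)) + 2 * ln (ln (real CARD('n)))"
    using ln_ge_zero[of "ln (real CARD('n))"] by linarith
  then have R: "R > 0" by (simp add: R_def)
  have "x powr (- 1 / 2) = 1 / sqrt x" if "0 < x" for x :: real
    using powr_minus_divide[of x "1 / 2"] powr_half_sqrt[of x] that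
    by (simp only: minus_divide_left less_imp_le)
  from this[OF pos] have "(2 * ln (real CARD('n)) + 2 * ln (ln (real CARD('n)))) powr (- 1 / 2) = 1 / R"
    unfolding R_def .
  moreover have "coord_sd P Z i \<ge> t * (1 / R) \<longleftrightarrow> S $ i $ i > 0 \<and> t / sqrt (S $ i $ i) \<le> R" for i
  proof (cases "S $ i $ i > 0")
    case True
    then show ?thesis using R by (simp add: coord_sd_eq field_simps)
  next
    case False
    then have "S $ i $ i = 0" using diag_nonneg[of i] by simp
    then show ?thesis using R t by (simp add: coord_sd_eq field_simps)
  qed
  ultimately show ?thesis by (simp add: effective_dim_def R_def[symmetric])
qed

text \<open>Every coordinate whose ratio at \<open>s\<close> is below the threshold has an even
  smaller ratio at \<open>t\<close>, so the effective dimension at \<open>t\<close> serves as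
  \<open>m\<close> for all \<open>s > t\<close>.\<close>

lemma density_bounds:
  assumes "CARD('n) \<ge> 3" "0 < t" "t < s" "inj idx"
  shows "s * (\<Sum>i | S $ i $ i > 0. normal_density 0 (sqrt (S $ i $ i)) s * face_prob idx i s) \<le>
      4 * ln (real (effective_dim P Z t)) + 1" (is "?f \<le> _")
    and "s * (\<Sum>i | S $ i $ i > 0. normal_density 0 (sqrt (S $ i $ i)) s * face_prob idx i s) \<le>
      4 * ln (real CARD('n))"
proof -
  define p where "p = real CARD('n)"
  define r where "r i = s / sqrt (S $ i $ i)" for i
  define q where "q i = measure (gaussian_measure 0 (S $ i $ i)) {s<..}" for i
  define I where "I = {i. S $ i $ i > 0}"
  have f: "?f = (\<Sum>i\<in>I. r i * std_normal_density (r i) * face_prob idx i s)"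
    by (simp add: sum_distrib_left I_def r_def std_normal_density_scaled flip: mult.assoc)
  have I: "finite I" "real (card I) \<le> p"
    unfolding p_def by (auto intro!: card_mono)
  have p: "3 \<le> p" using assms by (simp add: p_def)
  have nonneg: "0 \<le> r i \<and> 0 \<le> face_prob idx i s \<and> face_prob idx i s \<le> 1 \<and> 0 \<le> q i" if "i \<in> I" for i
    using that assms by (auto simp: I_def r_def q_def face_prob_nonneg face_prob_le_1)
  have Mills: "r i * std_normal_density (r i) \<le> ((r i)\<^sup>2 + 1) * q i" if "i \<in> I" for i
    using Mills_ratio_bound[of "sqrt (S $ i $ i)" s] that assms
    by (simp add: I_def r_def q_def gaussian_measure_def std_normal_density_scaled)
  have total: "(\<Sum>i\<in>I. q i * face_prob idx i s) \<le> 1"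
    unfolding I_def q_def by (rule sum_normal_strips_le_1[OF \<open>inj idx\<close>])
  have "card {i \<in> I. r i \<le> sqrt (2 * ln p + 2 * ln (ln p))} \<le>
      card {i. S $ i $ i > 0 \<and> t / sqrt (S $ i $ i) \<le> sqrt (2 * ln p + 2 * ln (ln p))}"
  proof (rule card_mono)
    have "t / sqrt (S $ i $ i) \<le> r i" if "S $ i $ i > 0" for i
      unfolding r_def using that assms by (intro divide_right_mono) auto
    then show "{i \<in> I. r i \<le> sqrt (2 * ln p + 2 * ln (ln p))} \<subseteq>
        {i. S $ i $ i > 0 \<and> t / sqrt (S $ i $ i) \<le> sqrt (2 * ln p + 2 * ln (ln p))}"
      by (auto simp: I_def intro: order_trans)
  qed simp
  then have m: "real (card {i \<in> I. r i \<le> sqrt (2 * ln p + 2 * ln (ln p))}) \<le> real (effective_dim P Z t)"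
    "2 \<le> real (effective_dim P Z t)"
    unfolding effective_dim_eq[OF assms(1,2)] p_def by linarith+
  show "?f \<le> 4 * ln (real (effective_dim P Z t)) + 1" "?f \<le> 4 * ln (real CARD('n))"
    unfolding f p_def[symmetric] by (rule sum_le_ln_bounds[OF I p nonneg Mills total m]; assumption)+
qed

end

theorem proposition3:
  fixes P :: "'a measure" and Z :: "'a \<Rightarrow> real^'n" and \<Sigma> :: "real^'n^'n" and t :: real
  assumes "CARD('n) \<ge> 3"
    and "pos_semidefinite \<Sigma>"
    and "centered_gaussian_vector P Z \<Sigma>"
    and "t > 0"
  shows "\<exists>L. ((\<lambda>\<delta>. 1 / \<delta> * measure P {\<omega> \<in> space P. t \<le> (MAX i. Z \<omega> $ i) \<and> (MAX i. Z \<omega> $ i) < t + \<delta>})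
               \<longlongrightarrow> L) (at_right 0) \<and>
             L \<le> 4 * min ((ln (real (effective_dim P Z t)) + 1 / 4) / t) (ln (real CARD('n)) / t)"
proof -
  interpret centered_gaussian P Z \<Sigma> using assms by unfold_locales
  obtain idx :: "'n \<Rightarrow> nat" where idx: "inj idx"
    using finite_imp_inj_to_nat_seg[of "UNIV :: 'n set"] by auto
  define I where "I = {i. \<Sigma> $ i $ i > 0}"
  define h where "h i s = normal_density 0 (sqrt (\<Sigma> $ i $ i)) s * face_prob idx i s" for i s
  have "\<forall>i. \<exists>l. (face_prob idx i \<longlongrightarrow> l) (at_right t)"
    using face_prob_at_right by blast
  then obtain l where l: "\<And>i. (face_prob idx i \<longlongrightarrow> l i) (at_right t)"
    by metis
  define L where "L = (\<Sum>i\<in>I. normal_density 0 (sqrt (\<Sigma> $ i $ i)) t * l i)"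
  have h_lim: "(h i \<longlongrightarrow> normal_density 0 (sqrt (\<Sigma> $ i $ i)) t * l i) (at_right t)" if "i \<in> I" for i
  proof -
    have "isCont (normal_density 0 (sqrt (\<Sigma> $ i $ i))) t"
      using that by (intro DERIV_isCont[OF normal_density_DERIV]) (simp add: I_def)
    then have "(normal_density 0 (sqrt (\<Sigma> $ i $ i)) \<longlongrightarrow> normal_density 0 (sqrt (\<Sigma> $ i $ i)) t) (at_right t)"
      unfolding isCont_def by (rule filterlim_mono) (auto simp: at_le)
    then show ?thesis unfolding h_def by (intro tendsto_mult l)
  qed
  \<comment> \<open>The uniform bound that \<open>tendsto_average_right\<close> requires: the peak
    of the density times a probability.\<close>
  have h_bound: "\<bar>h i s\<bar> \<le> 1 / sqrt (2 * pi * \<Sigma> $ i $ i)" if "i \<in> I" for i s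
  proof -
    have "normal_density 0 (sqrt (\<Sigma> $ i $ i)) s \<le> 1 / sqrt (2 * pi * \<Sigma> $ i $ i)"
      using that by (simp add: normal_density_def I_def divide_right_mono)
    then have "h i s \<le> 1 / sqrt (2 * pi * \<Sigma> $ i $ i) * 1"
      unfolding h_def using that by (intro mult_mono face_prob_le_1 face_prob_nonneg) (auto simp: I_def)
    then show ?thesis by (simp add: h_def face_prob_nonneg)
  qed
  have h_borel: "h i \<in> borel_measurable borel" for i
    unfolding h_def by measurable
  have "((\<lambda>\<delta>. \<Sum>i\<in>I. 1 / \<delta> * (\<integral>s. indicator {t..<t + \<delta>} s * h i s \<partial>lborel)) \<longlongrightarrow> L) (at_right 0)"
    unfolding L_def
    by (intro tendsto_sum tendsto_average_right[OF h_borel h_bound h_lim])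
  moreover have "1 / \<delta> * measure P {\<omega> \<in> space P. t \<le> (MAX i. Z \<omega> $ i) \<and> (MAX i. Z \<omega> $ i) < t + \<delta>} =
      (\<Sum>i\<in>I. 1 / \<delta> * (\<integral>s. indicator {t..<t + \<delta>} s * h i s \<partial>lborel))" for \<delta>
    using measure_Max[OF idx, of "{t..<t + \<delta>}"] \<open>t > 0\<close>
    by (simp add: sum_distrib_left h_def I_def)
  ultimately have lim: "((\<lambda>\<delta>. 1 / \<delta> * measure P {\<omega> \<in> space P. t \<le> (MAX i. Z \<omega> $ i) \<and> (MAX i. Z \<omega> $ i) < t + \<delta>})
      \<longlongrightarrow> L) (at_right 0)"
    by simp
  \<comment> \<open>The bounds hold for every \<open>s > t\<close> with right-hand sides free of
    \<open>s\<close>, so they pass to the right limit.\<close>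
  have "((\<lambda>s. s * (\<Sum>i\<in>I. h i s)) \<longlongrightarrow> t * L) (at_right t)"
    unfolding L_def by (intro tendsto_mult tendsto_sum h_lim tendsto_ident_at)
  then have upper: "t * L \<le> B" if "\<And>s. t < s \<Longrightarrow> s * (\<Sum>i\<in>I. h i s) \<le> B" for B
    by (rule tendsto_upperbound) (use that in \<open>auto intro: eventually_mono[OF eventually_at_right_less]\<close>)
  have "t * L \<le> 4 * ln (real (effective_dim P Z t)) + 1" "t * L \<le> 4 * ln (real CARD('n))"
    by (rule upper, unfold I_def h_def, rule density_bounds[OF assms(1,4) _ idx], assumption)+
  then have "L \<le> 4 * min ((ln (real (effective_dim P Z t)) + 1 / 4) / t) (ln (real CARD('n)) / t)"
    using \<open>t > 0\<close> by (simp add: min_def field_simps)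
  with lim show ?thesis by blast
qed

end
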